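(* There exist absolute constants $C,C'>0$ such that the following holds. Suppose $P$ is weakly communicating, $\delta\in(0,1)$, and $n$ is such that $\gamma:=1-\sqrt{C\log^3(SAn^2/\delta)/n}\in(0,1)$. Then with probability at least $1-\delta$, every policy $\widehat\pi$ satisfying $\widehat V^{\widehat\pi}_\gamma\ge\widehat V^\star_\gamma-\frac1n\mathbf 1$ satisfies $$\rho^\star-\rho^{\widehat\pi}\le\sqrt{\frac{C'\log^3\!\big(\frac{SAn}{\delta}\big)}{n}\big(\|h^\star\|_{\mathrm{sp}}^2+1\big)}\;\mathbf 1 .$$
   Context: $\mathcal S$ finite with $S$ states, $\mathcal A$ finite with $A$ actions; transition kernel $P$; known reward $r:\mathcal S\times\mathcal A\to[0,1]$. Policies stationary Markov, possibly randomized; $P_\pi,r_\pi$ induced matrix/reward. Empirical kernel $\widehat P$: $n$ i.i.d. samples from each $P(\cdot|s,a)$, independent across pairs, $\widehat P(s'|s,a)$ = fraction equal to $s'$. $\widehat V^\pi_\gamma=(I-\gamma\widehat P_\pi)^{-1}r_\pi$, $\widehat V^\star_\gamma=\max_\pi\widehat V^\pi_\gamma$. Gain $\rho^\pi=P^\infty_\pi r_\pi$ ($P^\infty_\pi$ Cesàro limit of $P_\pi^t$), bias $h^\pi=\mathrm{C\text{-}lim}_T\sum_{t<T}(P^t_\pi r_\pi-\rho^\pi)$; $\rho^\star,h^\star$ gain and bias of a Blackwell-optimal policy of $(P,r)$. $\|x\|_{\mathrm{sp}}=\max x-\min x$. Weakly communicating: states split into states transient under every stationary policy and a set where every state is reachable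 from every other. *)

theory Defs
  imports "HOL-Probability.Probability"
begin

(* States are {0..<S}, actions {0..<A} (explicit carriers, so that the absolute
   constants do not depend on S, A).  Vectors: nat => real, matrices: nat => nat => real,
   kernels: P s a s'. *)

definition is_kernel :: "nat \<Rightarrow> nat \<Rightarrow> (nat \<Rightarrow> nat \<Rightarrow> nat \<Rightarrow> real) \<Rightarrow> bool" where
  "is_kernel S A P \<longleftrightarrow> (\<forall>s<S. \<forall>a<A. (\<forall>s'. P s a s' \<ge> 0) \<and> (\<Sum>s'<S. P s a s') = 1)"

definition is_reward :: "nat \<Rightarrow> nat \<Rightarrow> (nat \<Rightarrow> nat \<Rightarrow> real) \<Rightarrow> bool" where
  "is_reward S A r \<longleftrightarrow> (\<forall>s<S. \<forall>a<A. 0 \<le> r s a \<and> r s a \<le> 1)"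

definition is_policy :: "nat \<Rightarrow> nat \<Rightarrow> (nat \<Rightarrow> nat \<Rightarrow> real) \<Rightarrow> bool" where
  "is_policy S A \<pi> \<longleftrightarrow> (\<forall>s<S. (\<forall>a<A. \<pi> s a \<ge> 0) \<and> (\<Sum>a<A. \<pi> s a) = 1)"

definition P_pol :: "nat \<Rightarrow> (nat \<Rightarrow> nat \<Rightarrow> nat \<Rightarrow> real) \<Rightarrow> (nat \<Rightarrow> nat \<Rightarrow> real) \<Rightarrow> nat \<Rightarrow> nat \<Rightarrow> real" where
  "P_pol A P \<pi> s s' = (\<Sum>a<A. \<pi> s a * P s a s')"

definition r_pol :: "nat \<Rightarrow> (nat \<Rightarrow> nat \<Rightarrow> real) \<Rightarrow> (nat \<Rightarrow> nat \<Rightarrow> real) \<Rightarrow> nat \<Rightarrow> real" where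
  "r_pol A r \<pi> s = (\<Sum>a<A. \<pi> s a * r s a)"

fun matpow :: "nat \<Rightarrow> (nat \<Rightarrow> nat \<Rightarrow> real) \<Rightarrow> nat \<Rightarrow> nat \<Rightarrow> nat \<Rightarrow> real" where
  "matpow S M 0 = (\<lambda>s s'. if s = s' then 1 else 0)"
| "matpow S M (Suc t) = (\<lambda>s s'. \<Sum>k<S. M s k * matpow S M t k s')"

definition mat_vec :: "nat \<Rightarrow> (nat \<Rightarrow> nat \<Rightarrow> real) \<Rightarrow> (nat \<Rightarrow> real) \<Rightarrow> nat \<Rightarrow> real" where
  "mat_vec S M v s = (\<Sum>s'<S. M s s' * v s')"

definition clim :: "(nat \<Rightarrow> real) \<Rightarrow> real" where
  "clim x = lim (\<lambda>N. (\<Sum>t<N. x t) / real N)"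

(* discounted value (I - gamma P_pi)^{-1} r_pi : the unique solution v of (I - gamma P_pi) v = r_pi
   on {0..<S} (extended by 0 outside the state space) *)
definition disc_value :: "nat \<Rightarrow> nat \<Rightarrow> (nat \<Rightarrow> nat \<Rightarrow> nat \<Rightarrow> real) \<Rightarrow> (nat \<Rightarrow> nat \<Rightarrow> real)
    \<Rightarrow> real \<Rightarrow> (nat \<Rightarrow> nat \<Rightarrow> real) \<Rightarrow> nat \<Rightarrow> real" where
  "disc_value S A P r \<gamma> \<pi> = (THE v. (\<forall>s. S \<le> s \<longrightarrow> v s = 0) \<and>
      (\<forall>s<S. v s - \<gamma> * mat_vec S (P_pol A P \<pi>) v s = r_pol A r \<pi> s))"

definition opt_disc_value :: "nat \<Rightarrow> nat \<Rightarrow> (nat \<Rightarrow> nat \<Rightarrow> nat \<Rightarrow> real) \<Rightarrow> (nat \<Rightarrow> nat \<Rightarrow> real)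
    \<Rightarrow> real \<Rightarrow> nat \<Rightarrow> real" where
  "opt_disc_value S A P r \<gamma> s = (SUP \<pi>\<in>{\<pi>. is_policy S A \<pi>}. disc_value S A P r \<gamma> \<pi> s)"

definition lim_mat :: "nat \<Rightarrow> (nat \<Rightarrow> nat \<Rightarrow> real) \<Rightarrow> nat \<Rightarrow> nat \<Rightarrow> real" where
  "lim_mat S M s s' = clim (\<lambda>t. matpow S M t s s')"

definition gain :: "nat \<Rightarrow> nat \<Rightarrow> (nat \<Rightarrow> nat \<Rightarrow> nat \<Rightarrow> real) \<Rightarrow> (nat \<Rightarrow> nat \<Rightarrow> real)
    \<Rightarrow> (nat \<Rightarrow> nat \<Rightarrow> real) \<Rightarrow> nat \<Rightarrow> real" where
  "gain S A P r \<pi> = mat_vec S (lim_mat S (P_pol A P \<pi>)) (r_pol A r \<pi>)"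

definition bias :: "nat \<Rightarrow> nat \<Rightarrow> (nat \<Rightarrow> nat \<Rightarrow> nat \<Rightarrow> real) \<Rightarrow> (nat \<Rightarrow> nat \<Rightarrow> real)
    \<Rightarrow> (nat \<Rightarrow> nat \<Rightarrow> real) \<Rightarrow> nat \<Rightarrow> real" where
  "bias S A P r \<pi> s = clim (\<lambda>T. \<Sum>t<T. (mat_vec S (matpow S (P_pol A P \<pi>) t) (r_pol A r \<pi>) s
                                         - gain S A P r \<pi> s))"

definition blackwell_optimal :: "nat \<Rightarrow> nat \<Rightarrow> (nat \<Rightarrow> nat \<Rightarrow> nat \<Rightarrow> real) \<Rightarrow> (nat \<Rightarrow> nat \<Rightarrow> real)
    \<Rightarrow> (nat \<Rightarrow> nat \<Rightarrow> real) \<Rightarrow> bool" where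
  "blackwell_optimal S A P r \<pi> \<longleftrightarrow> is_policy S A \<pi> \<and>
     (\<exists>\<gamma>0<1. \<forall>\<gamma>. \<gamma>0 < \<gamma> \<and> \<gamma> < 1 \<longrightarrow>
        (\<forall>\<pi>'. is_policy S A \<pi>' \<longrightarrow> (\<forall>s<S. disc_value S A P r \<gamma> \<pi>' s \<le> disc_value S A P r \<gamma> \<pi> s)))"

definition span_sp :: "nat \<Rightarrow> (nat \<Rightarrow> real) \<Rightarrow> real" where
  "span_sp S x = Max (x ` {..<S}) - Min (x ` {..<S})"

definition reachable :: "nat \<Rightarrow> nat \<Rightarrow> (nat \<Rightarrow> nat \<Rightarrow> nat \<Rightarrow> real) \<Rightarrow> nat \<Rightarrow> nat \<Rightarrow> bool" where
  "reachable S A P s s' \<longleftrightarrow> (\<exists>\<pi>. is_policy S A \<pi> \<and> (\<exists>t. matpow S (P_pol A P \<pi>) t s s' > 0))"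

(* state s transient for the Markov chain with matrix M: expected number of visits finite *)
definition transient :: "nat \<Rightarrow> (nat \<Rightarrow> nat \<Rightarrow> real) \<Rightarrow> nat \<Rightarrow> bool" where
  "transient S M s \<longleftrightarrow> summable (\<lambda>t. matpow S M t s s)"

definition weakly_communicating :: "nat \<Rightarrow> nat \<Rightarrow> (nat \<Rightarrow> nat \<Rightarrow> nat \<Rightarrow> real) \<Rightarrow> bool" where
  "weakly_communicating S A P \<longleftrightarrow> (\<exists>R \<subseteq> {..<S}.
      (\<forall>s\<in>R. \<forall>s'\<in>R. reachable S A P s s') \<and>
      (\<forall>s\<in>{..<S} - R. \<forall>\<pi>. is_policy S A \<pi> \<longrightarrow> transient S (P_pol A P \<pi>) s))"

(* distribution of the data set: omega (s,a,i) = i-th sample from P(.|s,a), i < n,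
   all independent *)
definition sample_pmf :: "nat \<Rightarrow> nat \<Rightarrow> (nat \<Rightarrow> nat \<Rightarrow> nat \<Rightarrow> real) \<Rightarrow> nat \<Rightarrow> (nat \<times> nat \<times> nat \<Rightarrow> nat) pmf" where
  "sample_pmf S A P n = Pi_pmf ({..<S} \<times> {..<A} \<times> {..<n}) 0
      (\<lambda>(s, a, i). embed_pmf (\<lambda>s'. if s' < S then P s a s' else 0))"

definition emp_kernel :: "nat \<Rightarrow> (nat \<times> nat \<times> nat \<Rightarrow> nat) \<Rightarrow> nat \<Rightarrow> nat \<Rightarrow> nat \<Rightarrow> real" where
  "emp_kernel n \<omega> s a s' = real (card {i. i < n \<and> \<omega> (s, a, i) = s'}) / real n"

end

(* The discounted optimal value V of the empirical kernel K satisfies the Bellman equation of the true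
   kernel P up to the error (K - P) V.  Fix a pair (s,a).  Replacing its row by termination with final
   reward u gives a value that is independent of the samples at (s,a) and equals V for the right u, and
   it is 1-Lipschitz in u.  Hoeffding's inequality for u on a grid of mesh 1/n therefore bounds
   |(K - P) V| by eps (span V + O(1/n)) + O(1/n) with eps = sqrt (2 L / n), L = ln (S A n^2 / delta).

   Since P is weakly communicating, the gain m of a Blackwell optimal policy is constant and (m, h)
   solves the average-reward optimality inequality; both facts are read off the Laurent expansion
   m / (1 - gamma) + h + O(1 - gamma) of the discounted value.  Hence m / (1 - gamma) + h is a solution
   of the Bellman equation of P up to span h, and, because eps <= (1 - gamma) / 8, V stays within
   2 span h + O(1) of m / (1 - gamma) and span V <= 3 span h + 1.

   Finally, with Q the Cesaro limit of P_pi, multiplying v = r_pi + gamma K_pi v by Q gives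
   gain pi = (1 - gamma) Q v - gamma Q (K_pi - P_pi) v.  Both errors are O((1 - gamma) (span h + 1)). *)

theory Submission
  imports Defs
begin

section \<open>Discounted Bellman equations\<close>

text \<open>The difficulty is that V is computed from the very samples whose deviation is measured,
  and that the conclusion must hold for all near-optimal policies at once. Concentration is
  therefore proved only for the single optimal V; a near-optimal policy has its value within 1/n of
  V, so no union over policies occurs. There are S A (n^2 + 1) bad events: u lies in [0, n], because
  V <= 1 / (1 - gamma) <= n, and the grid of mesh 1/n has n^2 + 1 points there. This is the origin
  of S A n^2 in the logarithm.

  The bound on (K - P) V contains span V, which is in turn controlled by that bound. The circle
  closes because the error, divided by 1 - gamma, carries span V with a coefficient of at most 1/8.
  With (1 - gamma)^2 = 128 L^3 / n the quotient eps / (1 - gamma) is 1 / (8 L), so the argument uses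
  L >= 1. This follows from 0 < gamma < 1 and delta < 1 except when S = A = n = 1, where all
  policies have the same gain.\<close>

definition is_subkernel :: "nat \<Rightarrow> nat \<Rightarrow> (nat \<Rightarrow> nat \<Rightarrow> nat \<Rightarrow> real) \<Rightarrow> bool" where
  "is_subkernel S A K \<longleftrightarrow>
     (\<forall>s<S. \<forall>a<A. (\<forall>s'<S. 0 \<le> K s a s') \<and> (\<Sum>s'<S. K s a s') \<le> 1)"

text \<open>Stated as a relation on V rather than with a \<open>Max\<close>, so that either half can
  be used alone. Nothing is said about V outside \<open>{..<S}\<close>, hence solutions are unique
  only there. R is not confined to [0, 1]: in the leave-one-out model it contains u.\<close>

definition bellman_sol ::
  "nat \<Rightarrow> nat \<Rightarrow> (nat \<Rightarrow> nat \<Rightarrow> nat \<Rightarrow> real) \<Rightarrow> (nat \<Rightarrow> nat \<Rightarrow> real) \<Rightarrow> real \<Rightarrow> (nat \<Rightarrow> real) \<Rightarrow> bool"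
  where
  "bellman_sol S A K R \<gamma> V \<longleftrightarrow>
     (\<forall>s<S. (\<forall>a<A. R s a + \<gamma> * mat_vec S (\<lambda>x. K x a) V s \<le> V s) \<and>
            (\<exists>a<A. V s = R s a + \<gamma> * mat_vec S (\<lambda>x. K x a) V s))"

lemma is_kernel_subkernel: "is_kernel S A K \<Longrightarrow> is_subkernel S A K"
  by (simp add: is_kernel_def is_subkernel_def)

text \<open>At a maximizer of w the hypothesis gives m <= \<gamma> m if m > 0. The row p may vary
  with s, so it can be the row of whatever action attains a value there. Mass at most 1 admits the
  zero row of the leave-one-out model.\<close>

lemma discounted_max_principle:
  fixes w :: "nat \<Rightarrow> real"
  assumes \<gamma>: "0 \<le> \<gamma>" "\<gamma> < 1"
    and w: "\<And>s. s < S \<Longrightarrow> \<exists>p. (\<forall>x<S. 0 \<le> p x) \<and> (\<Sum>x<S. p x) \<le> 1 \<and> w s \<le> \<gamma> * (\<Sum>x<S. p x * w x)"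
    and "s < S"
  shows "w s \<le> 0"
proof -
  define m where "m = Max (w ` {..<S})"
  have "m \<in> w ` {..<S}" unfolding m_def by (rule Max_in) (use \<open>s < S\<close> in auto)
  then obtain z where z: "z < S" "w z = m" by auto
  have le: "w x \<le> m" if "x < S" for x using that by (simp add: m_def)
  obtain p where p: "\<forall>x<S. 0 \<le> p x" "(\<Sum>x<S. p x) \<le> 1" "w z \<le> \<gamma> * (\<Sum>x<S. p x * w x)"
    using w[OF z(1)] by blast
  have "m \<le> 0"
  proof (rule ccontr)
    assume "\<not> m \<le> 0"
    have "(\<Sum>x<S. p x * w x) \<le> (\<Sum>x<S. p x * m)"
      using p(1) le by (intro sum_mono mult_left_mono) auto
    also have "\<dots> = (\<Sum>x<S. p x) * m" by (simp add: sum_distrib_right)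
    also have "\<dots> \<le> 1 * m" using p(2) \<open>\<not> m \<le> 0\<close> by (intro mult_right_mono) auto
    finally have "\<gamma> * (\<Sum>x<S. p x * w x) \<le> \<gamma> * m" using \<gamma> by (intro mult_left_mono) auto
    then have "m \<le> \<gamma> * m" using p(3) z(2) by simp
    moreover have "\<gamma> * m < 1 * m" using \<gamma> \<open>\<not> m \<le> 0\<close> by (intro mult_strict_right_mono) auto
    ultimately show False by simp
  qed
  then show ?thesis using le[OF \<open>s < S\<close>] by simp
qed

text \<open>The row used at s is that of an action attaining \<open>V s\<close>; W only has to be a
  supersolution. Upper bounds for V thus reduce to exhibiting a test function.\<close>

lemma bellman_sol_le:
  assumes K: "is_subkernel S A K" and \<gamma>: "0 \<le> \<gamma>" "\<gamma> < 1" and V: "bellman_sol S A K R \<gamma> V"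
    and W: "\<And>s a. s < S \<Longrightarrow> a < A \<Longrightarrow> R s a + \<gamma> * mat_vec S (\<lambda>x. K x a) W s \<le> W s" and "s < S"
  shows "V s \<le> W s"
proof -
  have "V s - W s \<le> 0"
  proof (rule discounted_max_principle[OF \<gamma> _ \<open>s < S\<close>, where w = "\<lambda>s. V s - W s"])
    fix s assume s: "s < S"
    then obtain a where a: "a < A" "V s = R s a + \<gamma> * mat_vec S (\<lambda>x. K x a) V s"
      using V unfolding bellman_sol_def by blast
    have "V s - W s \<le> \<gamma> * mat_vec S (\<lambda>x. K x a) V s - \<gamma> * mat_vec S (\<lambda>x. K x a) W s"
      using a W[OF s a(1)] by simp
    also have "\<dots> = \<gamma> * (\<Sum>x<S. K s a x * (V x - W x))"
      by (simp add: mat_vec_def right_diff_distrib sum_subtractf)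
    finally show "\<exists>p. (\<forall>x<S. 0 \<le> p x) \<and> (\<Sum>x<S. p x) \<le> 1 \<and> V s - W s \<le> \<gamma> * (\<Sum>x<S. p x * (V x - W x))"
      using K s a(1) unfolding is_subkernel_def by blast
  qed
  then show ?thesis by simp
qed

lemma mat_vec_mono:
  assumes "\<And>x. x < S \<Longrightarrow> 0 \<le> M s x" "\<And>x. x < S \<Longrightarrow> v x \<le> w x"
  shows "mat_vec S M v s \<le> mat_vec S M w s"
  unfolding mat_vec_def using assms by (intro sum_mono mult_left_mono) auto

text \<open>Value iteration from 0: nonnegative rewards make it increasing, bounded rewards keep it
  bounded, and monotone limits state by state take the place of a contraction argument.\<close>

lemma bellman_sol_exists:
  assumes K: "is_subkernel S A K" and \<gamma>: "0 \<le> \<gamma>" "\<gamma> < 1" and "0 < A"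
    and R: "\<And>s a. s < S \<Longrightarrow> a < A \<Longrightarrow> 0 \<le> R s a \<and> R s a \<le> B"
  shows "\<exists>V. bellman_sol S A K R \<gamma> V"
proof -
  define q where "q v s a = R s a + \<gamma> * mat_vec S (\<lambda>x. K x a) v s" for v s a
  define v where "v = rec_nat (\<lambda>s. 0) (\<lambda>_ v s. Max (q v s ` {..<A}))"
  have v0: "v 0 s = 0" and vS: "v (Suc k) s = Max (q (v k) s ` {..<A})" for k s
    by (simp_all add: v_def)
  have Knn: "0 \<le> K s a x" if "s < S" "a < A" "x < S" for s a x
    using K that by (simp add: is_subkernel_def)
  have q_mono: "q v s a \<le> q w s a" if "s < S" "a < A" "\<And>x. x < S \<Longrightarrow> v x \<le> w x" for v w s a
    unfolding q_def using that \<gamma> Knn by (intro add_left_mono mult_left_mono mat_vec_mono) auto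
  have ge: "q (v k) s a \<le> v (Suc k) s" if "a < A" for k s a
    unfolding vS using that by (intro Max_ge) auto
  have att: "\<exists>a<A. v (Suc k) s = q (v k) s a" for k s
  proof -
    have "v (Suc k) s \<in> q (v k) s ` {..<A}" unfolding vS using \<open>0 < A\<close> by (intro Max_in) auto
    then show ?thesis by auto
  qed
  have inc: "v k s \<le> v (Suc k) s" if "s < S" for k s
    using that
  proof (induction k arbitrary: s)
    case 0
    obtain a where "a < A" "v (Suc 0) s = q (v 0) s a" using att by blast
    then show ?case using R[OF 0] by (simp add: v0 q_def mat_vec_def)
  next
    case (Suc k)
    obtain a where a: "a < A" "v (Suc k) s = q (v k) s a" using att by blast
    note a(2)
    also have "q (v k) s a \<le> q (v (Suc k)) s a" using q_mono[OF Suc.prems a(1)] Suc.IH by blast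
    also have "\<dots> \<le> v (Suc (Suc k)) s" using ge a(1) by blast
    finally show ?case .
  qed
  have bd: "v k s \<le> max 0 B / (1 - \<gamma>)" if "s < S" for k s
    using that
  proof (induction k arbitrary: s)
    case 0
    then show ?case using \<gamma> by (simp add: v0)
  next
    case (Suc k)
    let ?c = "max 0 B / (1 - \<gamma>)"
    obtain a where a: "a < A" "v (Suc k) s = q (v k) s a" using att by blast
    have "mat_vec S (\<lambda>x. K x a) (v k) s \<le> mat_vec S (\<lambda>x. K x a) (\<lambda>_. ?c) s"
      using Suc Knn a(1) by (intro mat_vec_mono) auto
    also have "\<dots> = (\<Sum>x<S. K s a x) * ?c" by (simp add: mat_vec_def sum_distrib_right sum_divide_distrib)
    also have "\<dots> \<le> 1 * ?c"
      using K Suc.prems a(1) \<gamma> by (intro mult_right_mono) (auto simp: is_subkernel_def)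
    finally have "\<gamma> * mat_vec S (\<lambda>x. K x a) (v k) s \<le> \<gamma> * ?c" using \<gamma> by (intro mult_left_mono) auto
    then have "v (Suc k) s \<le> max 0 B + \<gamma> * ?c" using R[OF Suc.prems a(1)] by (simp add: a(2) q_def)
    also have "\<dots> = ?c" using \<gamma> by (simp add: field_simps)
    finally show ?case .
  qed
  define V where "V s = lim (\<lambda>k. v k s)" for s
  have conv: "(\<lambda>k. v k s) \<longlonglongrightarrow> V s" and up: "v k s \<le> V s" if "s < S" for s k
  proof -
    have "incseq (\<lambda>k. v k s)" using inc[OF that] by (rule incseq_SucI)
    moreover have "\<forall>k. v k s \<le> max 0 B / (1 - \<gamma>)" using bd[OF that] by blast
    ultimately obtain L where L: "(\<lambda>k. v k s) \<longlonglongrightarrow> L" "\<forall>i. v i s \<le> L"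
      by (rule incseq_convergent)
    then show "(\<lambda>k. v k s) \<longlonglongrightarrow> V s" "v k s \<le> V s" unfolding V_def using limI[OF L(1)] by auto
  qed
  have convq: "(\<lambda>k. q (v k) s a) \<longlonglongrightarrow> q V s a" for s a
    unfolding q_def mat_vec_def by (intro tendsto_intros conv) auto
  have "bellman_sol S A K R \<gamma> V" unfolding bellman_sol_def q_def[symmetric]
  proof (intro allI impI conjI)
    fix s a assume s: "s < S" and a: "a < A"
    show "q V s a \<le> V s"
      using LIMSEQ_le[OF convq LIMSEQ_Suc[OF conv[OF s]]] ge[OF a] by blast
  next
    fix s assume s: "s < S"
    define m where "m = Max (q V s ` {..<A})"
    have "m \<in> q V s ` {..<A}" unfolding m_def using \<open>0 < A\<close> by (intro Max_in) auto
    then obtain b where b: "b < A" "m = q V s b" by auto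
    have "v (Suc k) s \<le> m" for k
    proof -
      obtain a where a: "a < A" "v (Suc k) s = q (v k) s a" using att by blast
      note a(2)
      also have "q (v k) s a \<le> q V s a" using q_mono[OF s a(1)] up by blast
      also have "\<dots> \<le> m" unfolding m_def using a(1) by (intro Max_ge) auto
      finally show ?thesis .
    qed
    then have "V s \<le> m" using LIMSEQ_le_const2[OF LIMSEQ_Suc[OF conv[OF s]]] by blast
    moreover have "m \<le> V s"
      using LIMSEQ_le[OF convq LIMSEQ_Suc[OF conv[OF s]]] ge[OF b(1)] b(2) by blast
    ultimately show "\<exists>a<A. V s = q V s a" using b by auto
  qed
  then show ?thesis by blast
qed

section \<open>Discounted values of stationary policies\<close>

definition is_stoch :: "nat \<Rightarrow> (nat \<Rightarrow> nat \<Rightarrow> real) \<Rightarrow> bool" where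
  "is_stoch S M \<longleftrightarrow> (\<forall>s<S. (\<forall>x<S. 0 \<le> M s x) \<and> (\<Sum>x<S. M s x) = 1)"

lemma mat_vec_P_pol:
  "mat_vec S (P_pol A P \<pi>) v s = (\<Sum>a<A. \<pi> s a * mat_vec S (\<lambda>x. P x a) v s)"
  unfolding mat_vec_def P_pol_def sum_distrib_right sum_distrib_left
  by (subst sum.swap) (simp add: mult.assoc)

lemma is_stoch_P_pol:
  assumes "is_kernel S A P" "is_policy S A \<pi>"
  shows "is_stoch S (P_pol A P \<pi>)"
  unfolding is_stoch_def
proof (intro allI impI conjI)
  fix s x assume "s < S" "x < S"
  then show "0 \<le> P_pol A P \<pi> s x"
    using assms unfolding P_pol_def is_kernel_def is_policy_def by (intro sum_nonneg mult_nonneg_nonneg) auto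
next
  fix s assume s: "s < S"
  have "(\<Sum>x<S. P_pol A P \<pi> s x) = mat_vec S (P_pol A P \<pi>) (\<lambda>_. 1) s" by (simp add: mat_vec_def)
  also have "\<dots> = (\<Sum>a<A. \<pi> s a * (\<Sum>x<S. P s a x))" 
    unfolding mat_vec_P_pol by (simp add: mat_vec_def)
  also have "\<dots> = (\<Sum>a<A. \<pi> s a * 1)" using assms(1) s unfolding is_kernel_def by (intro sum.cong) auto
  finally show "(\<Sum>x<S. P_pol A P \<pi> s x) = 1" using assms(2) s by (simp add: is_policy_def)
qed

lemma sum_policy_le:
  assumes "is_policy S A \<pi>" "s < S" "\<And>a. a < A \<Longrightarrow> f a \<le> c"
  shows "(\<Sum>a<A. \<pi> s a * f a) \<le> c"
proof -
  have "(\<Sum>a<A. \<pi> s a * f a) \<le> (\<Sum>a<A. \<pi> s a * c)"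
    using assms unfolding is_policy_def by (intro sum_mono mult_left_mono) auto
  also have "\<dots> = c" using assms by (simp add: sum_distrib_right[symmetric] is_policy_def)
  finally show ?thesis .
qed

lemma r_pol_bounds:
  assumes "is_reward S A r" "is_policy S A \<pi>" "s < S"
  shows "0 \<le> r_pol A r \<pi> s" "r_pol A r \<pi> s \<le> 1"
proof -
  show "0 \<le> r_pol A r \<pi> s"
    unfolding r_pol_def using assms unfolding is_reward_def is_policy_def
    by (intro sum_nonneg mult_nonneg_nonneg) auto
  show "r_pol A r \<pi> s \<le> 1"
    unfolding r_pol_def by (rule sum_policy_le[OF assms(2,3)]) (use assms in \<open>auto simp: is_reward_def\<close>)
qed

text \<open>The maximum principle for w - c / (1 - \<gamma>): a stochastic matrix fixes constants,
  so the shift absorbs c.\<close>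

lemma stoch_discounted_le:
  assumes M: "is_stoch S M" and \<gamma>: "0 \<le> \<gamma>" "\<gamma> < 1"
    and w: "\<And>s. s < S \<Longrightarrow> w s \<le> \<gamma> * mat_vec S M w s + c" and "s < S"
  shows "w s \<le> c / (1 - \<gamma>)"
proof -
  have "w s - c / (1 - \<gamma>) \<le> 0"
  proof (rule discounted_max_principle[OF \<gamma> _ \<open>s < S\<close>, where w = "\<lambda>s. w s - c / (1 - \<gamma>)"])
    fix s assume s: "s < S"
    have "(\<Sum>x<S. M s x * (w x - c / (1 - \<gamma>))) = mat_vec S M w s - (\<Sum>x<S. M s x) * (c / (1 - \<gamma>))"
      by (simp only: mat_vec_def right_diff_distrib sum_subtractf sum_distrib_right)
    also have "\<dots> = mat_vec S M w s - c / (1 - \<gamma>)" using M s by (simp add: is_stoch_def)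
    finally have "\<gamma> * (\<Sum>x<S. M s x * (w x - c / (1 - \<gamma>))) = \<gamma> * (mat_vec S M w s - c / (1 - \<gamma>))"
      by simp
    also have "\<dots> = \<gamma> * mat_vec S M w s + c - c / (1 - \<gamma>)"
      using \<gamma> by (simp add: field_simps)
    finally have "\<gamma> * (\<Sum>x<S. M s x * (w x - c / (1 - \<gamma>))) = \<gamma> * mat_vec S M w s + c - c / (1 - \<gamma>)" .
    then have "w s - c / (1 - \<gamma>) \<le> \<gamma> * (\<Sum>x<S. M s x * (w x - c / (1 - \<gamma>)))" using w[OF s] by simp
    then show "\<exists>p. (\<forall>x<S. 0 \<le> p x) \<and> (\<Sum>x<S. p x) \<le> 1 \<and>
        w s - c / (1 - \<gamma>) \<le> \<gamma> * (\<Sum>x<S. p x * (w x - c / (1 - \<gamma>)))"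
      using M s unfolding is_stoch_def by (intro exI[of _ "M s"]) auto
  qed
  then show ?thesis by simp
qed

lemma mat_vec_diff: "mat_vec S M (\<lambda>x. v x - w x) s = mat_vec S M v s - mat_vec S M w s"
  by (simp add: mat_vec_def right_diff_distrib sum_subtractf)

lemma mat_vec_cong: "(\<And>x. x < S \<Longrightarrow> v x = w x) \<Longrightarrow> mat_vec S M v s = mat_vec S M w s"
  by (simp add: mat_vec_def)

text \<open>Justifies the \<open>THE\<close> in \<open>disc_value\<close>: a fixed policy is a
  decision process with one action, which gives existence, and comparison in both directions gives
  uniqueness on the states.\<close>

lemma disc_value_eq:
  assumes P: "is_kernel S A P" and r: "is_reward S A r" and \<pi>: "is_policy S A \<pi>" and \<gamma>: "0 \<le> \<gamma>" "\<gamma> < 1"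
    and "s < S"
  shows "disc_value S A P r \<gamma> \<pi> s
    = r_pol A r \<pi> s + \<gamma> * mat_vec S (P_pol A P \<pi>) (disc_value S A P r \<gamma> \<pi>) s"
proof -
  let ?M = "P_pol A P \<pi>"
  let ?sol = "\<lambda>v. (\<forall>s. S \<le> s \<longrightarrow> v s = 0) \<and> (\<forall>s<S. v s - \<gamma> * mat_vec S ?M v s = r_pol A r \<pi> s)"
  note M = is_stoch_P_pol[OF P \<pi>]
  have sub: "is_subkernel S 1 (\<lambda>s _. ?M s)" using M by (simp add: is_stoch_def is_subkernel_def)
  obtain V where V: "bellman_sol S 1 (\<lambda>s _. ?M s) (\<lambda>s _. r_pol A r \<pi> s) \<gamma> V"
    using bellman_sol_exists[OF sub \<gamma>, of "\<lambda>s _. r_pol A r \<pi> s" 1] r_pol_bounds[OF r \<pi>] by auto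
  \<comment> \<open>The defining property demands the value 0 outside the state space, which V need
    not have.\<close>
  define V' where "V' s = (if s < S then V s else 0)" for s
  have "mat_vec S ?M V' s = mat_vec S ?M V s" for s by (rule mat_vec_cong) (simp add: V'_def)
  then have V': "?sol V'" using V by (auto simp: V'_def bellman_sol_def)
  have uniq: "v = w" if v: "?sol v" and w: "?sol w" for v w
  proof
    fix s
    have le: "v s \<le> w s" if "s < S" "?sol v" "?sol w" for v w s
    proof -
      have "v s - w s \<le> 0 / (1 - \<gamma>)"
        by (rule stoch_discounted_le[OF M \<gamma> _ that(1), where w = "\<lambda>s. v s - w s"])
           (use that(2,3) in \<open>simp add: mat_vec_diff algebra_simps; smt (verit)\<close>)
      then show ?thesis by simp
    qed
    show "v s = w s"
    proof (cases "s < S")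
      case True
      then show ?thesis using le[OF True v w] le[OF True w v] by simp
    next
      case False
      then show ?thesis using v w by simp
    qed
  qed
  have "?sol (disc_value S A P r \<gamma> \<pi>)"
    unfolding disc_value_def by (rule theI[of ?sol, OF V' uniq[OF _ V']])
  then have "disc_value S A P r \<gamma> \<pi> s - \<gamma> * mat_vec S ?M (disc_value S A P r \<gamma> \<pi>) s = r_pol A r \<pi> s"
    using \<open>s < S\<close> by blast
  then show ?thesis by simp
qed

lemma disc_value_le_bellman:
  assumes P: "is_kernel S A P" and r: "is_reward S A r" and \<pi>: "is_policy S A \<pi>" and \<gamma>: "0 \<le> \<gamma>" "\<gamma> < 1"
    and V: "bellman_sol S A P r \<gamma> V" and "s < S"
  shows "disc_value S A P r \<gamma> \<pi> s \<le> V s"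
proof -
  let ?v = "disc_value S A P r \<gamma> \<pi>"
  have "?v s - V s \<le> 0 / (1 - \<gamma>)"
  proof (rule stoch_discounted_le[OF is_stoch_P_pol[OF P \<pi>] \<gamma> _ \<open>s < S\<close>, where w = "\<lambda>s. ?v s - V s"])
    fix s assume s: "s < S"
    have "r_pol A r \<pi> s + \<gamma> * mat_vec S (P_pol A P \<pi>) V s
        = (\<Sum>a<A. \<pi> s a * (r s a + \<gamma> * mat_vec S (\<lambda>x. P x a) V s))"
      by (simp add: r_pol_def mat_vec_P_pol distrib_left sum.distrib sum_distrib_left mult.left_commute)
    also have "\<dots> \<le> V s"
      using V s by (intro sum_policy_le[OF \<pi> s]) (auto simp: bellman_sol_def)
    finally show "?v s - V s \<le> \<gamma> * mat_vec S (P_pol A P \<pi>) (\<lambda>s. ?v s - V s) s + 0"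
      using disc_value_eq[OF P r \<pi> \<gamma> s] by (simp add: mat_vec_diff right_diff_distrib)
  qed
  then show ?thesis by simp
qed

text \<open>Choosing in each state an action that attains V turns the optimality equation into the
  linear equation of a deterministic policy, whose solution is unique. The supremum over randomized
  policies is therefore attained.\<close>

lemma bellman_greedy:
  assumes P: "is_kernel S A P" and r: "is_reward S A r" and \<gamma>: "0 \<le> \<gamma>" "\<gamma> < 1"
    and V: "bellman_sol S A P r \<gamma> V"
  obtains \<pi> where "is_policy S A \<pi>" "\<And>s. s < S \<Longrightarrow> disc_value S A P r \<gamma> \<pi> s = V s"
proof -
  have "\<forall>s. \<exists>a. s < S \<longrightarrow> a < A \<and> V s = r s a + \<gamma> * mat_vec S (\<lambda>x. P x a) V s"
    using V unfolding bellman_sol_def by blast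
  then obtain g where g: "\<And>s. s < S \<Longrightarrow> g s < A \<and> V s = r s (g s) + \<gamma> * mat_vec S (\<lambda>x. P x (g s)) V s"
    by metis
  define \<pi> :: "nat \<Rightarrow> nat \<Rightarrow> real" where "\<pi> s a = (if a = g s then 1 else 0)" for s a
  have pick: "(\<Sum>a<A. \<pi> s a * f a) = f (g s)" if "s < S" for s and f :: "nat \<Rightarrow> real"
  proof -
    have "(\<Sum>a<A. \<pi> s a * f a) = (\<Sum>a<A. if a = g s then f a else 0)"
      by (intro sum.cong) (auto simp: \<pi>_def)
    then show ?thesis using g[OF that] by simp
  qed
  have \<pi>: "is_policy S A \<pi>" unfolding is_policy_def
    using pick[of _ "\<lambda>_. 1"] by (simp add: \<pi>_def)
  have "V s \<le> disc_value S A P r \<gamma> \<pi> s" if "s < S" for s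
  proof -
    let ?v = "disc_value S A P r \<gamma> \<pi>"
    have "V s - ?v s \<le> 0 / (1 - \<gamma>)"
    proof (rule stoch_discounted_le[OF is_stoch_P_pol[OF P \<pi>] \<gamma> _ \<open>s < S\<close>, where w = "\<lambda>s. V s - ?v s"])
      fix s assume s: "s < S"
      have "V s = r_pol A r \<pi> s + \<gamma> * mat_vec S (P_pol A P \<pi>) V s"
        using g[OF s] by (simp add: r_pol_def mat_vec_P_pol pick[OF s])
      then show "V s - ?v s \<le> \<gamma> * mat_vec S (P_pol A P \<pi>) (\<lambda>s. V s - ?v s) s + 0"
        using disc_value_eq[OF P r \<pi> \<gamma> s] by (simp add: mat_vec_diff right_diff_distrib)
    qed
    then show ?thesis by simp
  qed
  then show ?thesis
    using that[OF \<pi>] disc_value_le_bellman[OF P r \<pi> \<gamma> V] by (simp add: order_antisym)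
qed

lemma opt_disc_value_bellman:
  assumes P: "is_kernel S A P" and r: "is_reward S A r" and \<gamma>: "0 \<le> \<gamma>" "\<gamma> < 1"
    and V: "bellman_sol S A P r \<gamma> V" and s: "s < S"
  shows "opt_disc_value S A P r \<gamma> s = V s"
proof -
  obtain \<pi> where \<pi>: "is_policy S A \<pi>" "disc_value S A P r \<gamma> \<pi> s = V s"
    using bellman_greedy[OF P r \<gamma> V] s by metis
  show ?thesis unfolding opt_disc_value_def
  proof (rule cSup_eq_maximum)
    show "V s \<in> (\<lambda>\<pi>. disc_value S A P r \<gamma> \<pi> s) ` {\<pi>. is_policy S A \<pi>}"
      using \<pi> by (metis image_eqI mem_Collect_eq)
  qed (use disc_value_le_bellman[OF P r _ \<gamma> V s] in auto)
qed


section \<open>Gain and bias of a finite Markov chain\<close>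

text \<open>Elimination: a pivot vector p clears coordinate e from the others. It is applied to S +
  1 iterates of I - M on a vector with S coordinates, which yields a polynomial in I - M
  annihilating that vector.\<close>

lemma linear_dependence:
  fixes w :: "'i \<Rightarrow> 'e \<Rightarrow> real"
  assumes "finite E" "finite I" "card E < card I"
  shows "\<exists>c. (\<exists>i\<in>I. c i \<noteq> 0) \<and> (\<forall>e\<in>E. (\<Sum>i\<in>I. c i * w i e) = 0)"
  using assms
proof (induction E arbitrary: I w rule: finite_induct)
  case empty
  then have "I \<noteq> {}" by auto
  then show ?case by (intro exI[of _ "\<lambda>_. 1"]) auto
next
  case (insert e E)
  show ?case
  proof (cases "\<forall>i\<in>I. w i e = 0")
    case True
    have "card E < card I" using insert by simp
    from insert.IH[OF insert.prems(1) this, of w] obtain c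
      where "\<exists>i\<in>I. c i \<noteq> 0" "\<forall>e\<in>E. (\<Sum>i\<in>I. c i * w i e) = 0" by blast
    with True show ?thesis by (intro exI[of _ c]) auto
  next
    case False
    then obtain p where p: "p \<in> I" "w p e \<noteq> 0" by blast
    have "card E < card (I - {p})" using insert p by simp
    from insert.IH[OF _ this, of "\<lambda>i x. w i x - w i e / w p e * w p x"] insert.prems(1) obtain c
      where c: "\<exists>i\<in>I-{p}. c i \<noteq> 0"
        "\<And>x. x \<in> E \<Longrightarrow> (\<Sum>i\<in>I-{p}. c i * (w i x - w i e / w p e * w p x)) = 0" by blast
    \<comment> \<open>The coefficient of the pivot is chosen so that the relation between the
      reduced vectors becomes one between the original vectors.\<close>
    define d where "d = c(p := - (\<Sum>i\<in>I-{p}. c i * w i e / w p e))"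
    have sum_d: "(\<Sum>i\<in>I. d i * w i x) = (\<Sum>i\<in>I-{p}. c i * (w i x - w i e / w p e * w p x))" for x
    proof -
      have "(\<Sum>i\<in>I. d i * w i x) = d p * w p x + (\<Sum>i\<in>I-{p}. d i * w i x)"
        using insert.prems(1) p(1) by (rule sum.remove)
      also have "(\<Sum>i\<in>I-{p}. d i * w i x) = (\<Sum>i\<in>I-{p}. c i * w i x)"
        by (intro sum.cong) (auto simp: d_def)
      finally show ?thesis
        by (simp add: d_def right_diff_distrib sum_subtractf sum_distrib_right mult.assoc)
    qed
    have "(\<Sum>i\<in>I. d i * w i e) = 0" unfolding sum_d using p by simp
    moreover have "\<exists>i\<in>I. d i \<noteq> 0" using c(1) by (auto simp: d_def)
    ultimately show ?thesis using c(2) sum_d by (intro exI[of _ d]) auto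
  qed
qed

lemma mat_vec_sum:
  "mat_vec S M (\<lambda>x. \<Sum>i\<in>I. c i * f i x) s = (\<Sum>i\<in>I. c i * mat_vec S M (f i) s)"
  unfolding mat_vec_def sum_distrib_left by (subst sum.swap) (simp add: mult.left_commute)

lemma mat_vec_add: "mat_vec S M (\<lambda>x. v x + w x) s = mat_vec S M v s + mat_vec S M w s"
  by (simp add: mat_vec_def distrib_left sum.distrib)

lemma mat_vec_scale: "mat_vec S M (\<lambda>x. c * v x) s = c * mat_vec S M v s"
  by (simp add: mat_vec_def sum_distrib_left mult.left_commute)

lemma mat_vec_const: "is_stoch S M \<Longrightarrow> s < S \<Longrightarrow> mat_vec S M (\<lambda>_. c) s = c"
  by (simp add: mat_vec_def is_stoch_def sum_distrib_right[symmetric])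

lemma mat_vec_stoch_mono:
  assumes "is_stoch S M" "s < S" "\<And>x. x < S \<Longrightarrow> v x \<le> w x"
  shows "mat_vec S M v s \<le> mat_vec S M w s"
  using assms by (intro mat_vec_mono) (auto simp: is_stoch_def)

lemma mat_vec_stoch_bound:
  assumes M: "is_stoch S M" and s: "s < S" and v: "\<And>x. x < S \<Longrightarrow> \<bar>v x\<bar> \<le> B"
  shows "\<bar>mat_vec S M v s\<bar> \<le> B"
proof -
  have "mat_vec S M v s \<le> mat_vec S M (\<lambda>_. B) s"
    using v by (intro mat_vec_stoch_mono[OF M s]) (simp add: abs_le_iff)
  moreover have "mat_vec S M (\<lambda>_. -B) s \<le> mat_vec S M v s"
    using v by (intro mat_vec_stoch_mono[OF M s]) (fastforce simp: abs_le_iff)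
  ultimately show ?thesis using mat_vec_const[OF M s] by (simp add: abs_le_iff)
qed

lemma bound_exists: "\<exists>B\<ge>0. \<forall>s<S. \<bar>v s\<bar> \<le> (B::real)" for v :: "nat \<Rightarrow> real"
proof (intro exI conjI allI impI)
  show "0 \<le> (\<Sum>s<S. \<bar>v s\<bar>)" by (simp add: sum_nonneg)
  show "\<bar>v s\<bar> \<le> (\<Sum>s<S. \<bar>v s\<bar>)" if "s < S" for s using that by (intro member_le_sum) auto
qed

lemma mat_vec_funpow_bound:
  assumes M: "is_stoch S M" and v: "\<And>x. x < S \<Longrightarrow> \<bar>v x\<bar> \<le> B" and "s < S"
  shows "\<bar>(mat_vec S M ^^ t) v s\<bar> \<le> B"
  using \<open>s < S\<close> by (induction t arbitrary: s) (auto intro!: v mat_vec_stoch_bound[OF M])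

text \<open>The eigenvalue 1 of a stochastic matrix is semisimple, because its powers are bounded:
  \<open>M\<^sup>t x = x - t (I - M) x\<close> if \<open>(I - M)\<^sup>2 x = 0\<close>.\<close>

lemma stoch_index_one:
  assumes M: "is_stoch S M"
    and y: "\<And>s. s < S \<Longrightarrow> y s = x s - mat_vec S M x s" "\<And>s. s < S \<Longrightarrow> y s - mat_vec S M y s = 0"
    and "s < S"
  shows "y s = 0"
proof -
  have pow: "(mat_vec S M ^^ t) x s = x s - real t * y s" if "s < S" for t s
    using that
  proof (induction t arbitrary: s)
    case (Suc t)
    have "(mat_vec S M ^^ Suc t) x s = mat_vec S M (\<lambda>s. x s - real t * y s) s"
      using Suc.IH by (auto intro: mat_vec_cong)
    also have "\<dots> = mat_vec S M x s - real t * mat_vec S M y s"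
      by (simp add: mat_vec_diff mat_vec_scale)
    also have "\<dots> = x s - real (Suc t) * y s" using y[OF Suc.prems] by (simp add: algebra_simps)
    finally show ?case .
  qed simp
  obtain B where B: "\<forall>s<S. \<bar>x s\<bar> \<le> B" using bound_exists by blast
  have bd: "real t * \<bar>y s\<bar> \<le> 2 * B" for t
  proof -
    have "\<bar>x s - real t * y s\<bar> \<le> B"
      using mat_vec_funpow_bound[OF M, of x B s t] B \<open>s < S\<close> pow[OF \<open>s < S\<close>] by simp
    moreover have "\<bar>x s\<bar> \<le> B" using B \<open>s < S\<close> by blast
    ultimately have "\<bar>real t * y s\<bar> \<le> 2 * B" by linarith
    then show ?thesis by (simp add: abs_mult)
  qed
  show ?thesis
  proof (rule ccontr)
    assume "y s \<noteq> 0"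
    then obtain t where "2 * B < real t * \<bar>y s\<bar>" using ex_less_of_nat_mult[of "\<bar>y s\<bar>" "2 * B"] by auto
    then show False using bd[of t] by simp
  qed
qed

text \<open>The space is the sum of the kernel and the range of N = I - M, and \<rho> is the
  harmonic part. Take a linear relation among the iterates \<open>(N ^^ k) v\<close>, divide out its
  lowest power of N as far as semisimplicity allows, and solve for v.\<close>

lemma stoch_decomposition:
  assumes M: "is_stoch S M"
  shows "\<exists>\<rho> g. \<forall>s<S. mat_vec S M \<rho> s = \<rho> s \<and> v s = \<rho> s + g s - mat_vec S M g s"
proof -
  define N where "N v s = v s - mat_vec S M v s" for v s
  have N_eq: "N v s = v s - mat_vec S M v s" for v s by (simp add: N_def)
  have N_sum: "N (\<lambda>x. \<Sum>i\<in>I. c i * f i x) = (\<lambda>s. \<Sum>i\<in>I. c i * N (f i) s)"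
    for I :: "nat set" and c f
    by (auto simp: N_def mat_vec_sum right_diff_distrib sum_subtractf)
  have pow_sum: "(N ^^ j) (\<lambda>x. \<Sum>i\<in>I. c i * f i x) = (\<lambda>s. \<Sum>i\<in>I. c i * (N ^^ j) (f i) s)"
    for I :: "nat set" and c f j
    by (induction j) (auto simp: N_sum)
  obtain c where c: "\<exists>i\<in>{..S}. c i \<noteq> 0" "\<And>s. s < S \<Longrightarrow> (\<Sum>k\<le>S. c k * (N ^^ k) v s) = 0"
    using linear_dependence[of "{..<S}" "{..S}" "\<lambda>k. (N ^^ k) v"] by auto
  \<comment> \<open>j is the order at 0 of the annihilating polynomial; c j is nonzero, so v can be
    recovered at the end.\<close>
  define j where "j = (LEAST i. c i \<noteq> 0)"
  obtain i where i: "i \<le> S" "c i \<noteq> 0" using c(1) by auto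
  have cj: "c j \<noteq> 0" unfolding j_def using i(2) by (rule LeastI)
  have below: "c k = 0" if "k < j" for k using not_less_Least that unfolding j_def by blast
  have "j \<le> S" using Least_le[of "\<lambda>i. c i \<noteq> 0" i] i by (simp add: j_def)
  define y where "y s = (\<Sum>k\<in>{j..S}. c k * (N ^^ (k - j)) v s)" for s
  have "(N ^^ j) y s = 0" if "s < S" for s
  proof -
    have "(N ^^ j) y s = (\<Sum>k\<in>{j..S}. c k * (N ^^ j) ((N ^^ (k - j)) v) s)"
      unfolding y_def pow_sum ..
    also have "\<dots> = (\<Sum>k\<in>{j..S}. c k * (N ^^ k) v s)"
      by (intro sum.cong refl) (simp add: funpow_add[symmetric, THEN fun_cong, unfolded o_def])
    also have "\<dots> = (\<Sum>k\<le>S. c k * (N ^^ k) v s)"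
      by (rule sum.mono_neutral_left) (auto simp: below)
    finally show ?thesis using c(2)[OF that] by simp
  qed
  \<comment> \<open>Semisimplicity lowers an exponent of at least 2 by one, so it descends to 1.
    Exponent 0 is the case j = 0, where y itself vanishes on the states.\<close>
  moreover have "N y s = 0" if "\<forall>s<S. (N ^^ i) y s = 0" "s < S" for i s
    using that
  proof (induction i)
    case 0
    then have "mat_vec S M y s = mat_vec S M (\<lambda>_. 0) s" by (intro mat_vec_cong) auto
    then show ?case using 0 by (simp add: N_def mat_vec_def)
  next
    case (Suc i)
    show ?case
    proof (cases i)
      case 0
      then show ?thesis using Suc.prems by simp
    next
      case (Suc l)
      have "(N ^^ i) y s = 0" if "s < S" for s
        by (rule stoch_index_one[OF M _ _ that, of _ "(N ^^ l) y"])
           (use Suc.prems(1) in \<open>simp_all add: Suc N_eq[symmetric]\<close>)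
      then show ?thesis using Suc.IH Suc.prems(2) by blast
    qed
  qed
  ultimately have Ny: "N y s = 0" if "s < S" for s using that by blast
  \<comment> \<open>Splitting off the term k = j of y leaves a multiple of N, and u is the
    quotient.\<close>
  define u where "u s = (\<Sum>k\<in>{Suc j..S}. c k * (N ^^ (k - Suc j)) v s)" for s
  have yu: "y s = c j * v s + N u s" for s
  proof -
    have "N u s = (\<Sum>k\<in>{Suc j..S}. c k * N ((N ^^ (k - Suc j)) v) s)"
      unfolding u_def N_sum ..
    also have "\<dots> = (\<Sum>k\<in>{Suc j..S}. c k * (N ^^ (k - j)) v s)"
      by (intro sum.cong refl) (auto simp: Suc_diff_le[symmetric] funpow.simps(2)[THEN fun_cong, unfolded o_def, symmetric] simp del: funpow.simps)
    finally show ?thesis unfolding y_def using \<open>j \<le> S\<close> by (simp add: sum.atLeast_Suc_atMost)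
  qed
  show ?thesis
  proof (rule exI[of _ "\<lambda>s. inverse (c j) * y s"], rule exI[of _ "\<lambda>s. - inverse (c j) * u s"], intro allI impI conjI)
    fix s assume "s < S"
    then show "mat_vec S M (\<lambda>s. inverse (c j) * y s) s = inverse (c j) * y s"
      using Ny by (simp add: N_def mat_vec_scale)
    show "v s = inverse (c j) * y s + - inverse (c j) * u s - mat_vec S M (\<lambda>s. - inverse (c j) * u s) s"
      using cj unfolding mat_vec_scale yu N_def by (simp add: field_simps)
  qed
qed

section \<open>Powers of a stochastic matrix and their Cesaro limit\<close>

lemma matpow_mat_vec:
  "s < S \<Longrightarrow> mat_vec S (matpow S M t) v s = (mat_vec S M ^^ t) v s"
proof (induction t arbitrary: s)
  case 0
  have "(\<Sum>x<S. (if s = x then 1 else 0) * v x) = (\<Sum>x<S. if s = x then v x else 0)"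
    by (intro sum.cong) auto
  then show ?case using 0 by (simp add: mat_vec_def)
next
  case (Suc t)
  have "mat_vec S (matpow S M (Suc t)) v s = (\<Sum>k<S. M s k * mat_vec S (matpow S M t) v k)"
    unfolding mat_vec_def matpow.simps sum_distrib_right sum_distrib_left
    by (subst sum.swap) (simp add: mult.assoc)
  also have "\<dots> = mat_vec S M (mat_vec S (matpow S M t) v) s" by (simp only: mat_vec_def)
  also have "\<dots> = mat_vec S M ((mat_vec S M ^^ t) v) s" using Suc.IH by (rule mat_vec_cong)
  finally show ?case by simp
qed

lemma matpow_stoch: "is_stoch S M \<Longrightarrow> is_stoch S (matpow S M t)"
proof (induction t)
  case 0
  then show ?case by (simp add: is_stoch_def)
next
  case (Suc t)
  then have IH: "is_stoch S (matpow S M t)" by blast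
  show ?case unfolding is_stoch_def
  proof (intro allI impI conjI)
    fix s x assume "s < S" "x < S"
    then show "0 \<le> matpow S M (Suc t) s x"
      using IH Suc.prems by (auto simp: is_stoch_def intro!: sum_nonneg)
  next
    fix s assume s: "s < S"
    have "(\<Sum>x<S. matpow S M (Suc t) s x) = (\<Sum>k<S. M s k * (\<Sum>x<S. matpow S M t k x))"
      unfolding matpow.simps sum_distrib_left by (rule sum.swap)
    also have "\<dots> = (\<Sum>k<S. M s k)" using IH by (simp add: is_stoch_def)
    finally show "(\<Sum>x<S. matpow S M (Suc t) s x) = 1" using Suc.prems s by (simp add: is_stoch_def)
  qed
qed

lemma matpow_entry: "x < S \<Longrightarrow> matpow S M t s x = mat_vec S (matpow S M t) (\<lambda>y. if y = x then 1 else 0) s"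
proof -
  assume "x < S"
  have "mat_vec S (matpow S M t) (\<lambda>y. if y = x then 1 else 0) s = (\<Sum>y<S. if y = x then matpow S M t s y else 0)"
    unfolding mat_vec_def by (intro sum.cong) auto
  then show ?thesis using \<open>x < S\<close> by simp
qed

lemma funpow_telescope:
  assumes v: "\<And>s. s < S \<Longrightarrow> mat_vec S M \<rho> s = \<rho> s \<and> v s = \<rho> s + g s - mat_vec S M g s"
    and s: "s < S"
  shows "(mat_vec S M ^^ t) v s = \<rho> s + (mat_vec S M ^^ t) g s - (mat_vec S M ^^ Suc t) g s"
  using s
proof (induction t arbitrary: s)
  case 0
  then show ?case using v by simp
next
  case (Suc t)
  have "(mat_vec S M ^^ Suc t) v s
      = mat_vec S M (\<lambda>s. (\<rho> s + (mat_vec S M ^^ t) g s) - (mat_vec S M ^^ Suc t) g s) s"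
    using Suc.IH by (auto intro: mat_vec_cong)
  then show ?case using v[OF Suc.prems] unfolding mat_vec_diff mat_vec_add by simp
qed

text \<open>By telescoping, the partial sum is N \<rho> + g - M^N g, and the powers of M keep the
  last two terms bounded.\<close>

lemma cesaro_tendsto:
  assumes M: "is_stoch S M"
    and v: "\<And>s. s < S \<Longrightarrow> mat_vec S M \<rho> s = \<rho> s \<and> v s = \<rho> s + g s - mat_vec S M g s"
    and s: "s < S"
  shows "(\<lambda>N. (\<Sum>t<N. mat_vec S (matpow S M t) v s) / real N) \<longlonglongrightarrow> \<rho> s"
proof -
  let ?T = "\<lambda>t. (mat_vec S M ^^ t) g s"
  obtain B where B: "\<forall>s<S. \<bar>g s\<bar> \<le> B" using bound_exists by blast
  have eq: "(\<Sum>t<N. mat_vec S (matpow S M t) v s) = real N * \<rho> s + (g s - ?T N)" for N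
  proof -
    have "(\<Sum>t<N. mat_vec S (matpow S M t) v s) = (\<Sum>t<N. \<rho> s + (?T t - ?T (Suc t)))"
      using s by (simp add: matpow_mat_vec funpow_telescope[OF v s] add_diff_eq del: funpow.simps)
    also have "\<dots> = real N * \<rho> s + (?T 0 - ?T N)"
      by (simp only: sum.distrib sum_constant card_lessThan sum_lessThan_telescope'[of ?T N])
    finally show ?thesis by simp
  qed
  have "(\<lambda>N. (g s - ?T N) / real N) \<longlonglongrightarrow> 0"
  proof (rule Lim_null_comparison)
    show "\<forall>\<^sub>F N in sequentially. norm ((g s - ?T N) / real N) \<le> (2 * B) / real N"
    proof (intro always_eventually allI)
      fix N
      have "\<bar>g s - ?T N\<bar> \<le> 2 * B"
        using B s mat_vec_funpow_bound[OF M, of g B s N] by (smt (verit))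
      then show "norm ((g s - ?T N) / real N) \<le> (2 * B) / real N"
        by (simp add: divide_right_mono)
    qed
    show "(\<lambda>N. (2 * B) / real N) \<longlonglongrightarrow> 0" by (rule lim_const_over_n)
  qed
  then have "(\<lambda>N. \<rho> s + (g s - ?T N) / real N) \<longlonglongrightarrow> \<rho> s + 0" by (intro tendsto_intros)
  moreover have "\<forall>\<^sub>F N in sequentially. \<rho> s + (g s - ?T N) / real N
      = (\<Sum>t<N. mat_vec S (matpow S M t) v s) / real N"
    using eventually_gt_at_top[of 0] by eventually_elim (simp add: eq field_simps)
  ultimately show ?thesis by (simp add: tendsto_cong)
qed

text \<open>\<open>lim_mat\<close> is defined by \<open>lim\<close>, which is informative only once
  convergence is known; the decomposition of a unit vector supplies it entry by entry.\<close>

lemma lim_mat_tendsto: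
  assumes M: "is_stoch S M" and s: "s < S" and x: "x < S"
  shows "(\<lambda>N. (\<Sum>t<N. matpow S M t s x) / real N) \<longlonglongrightarrow> lim_mat S M s x"
proof -
  let ?e = "\<lambda>y. if y = x then 1 else 0 :: real"
  obtain \<rho> g where dec: "\<And>s. s < S \<Longrightarrow> mat_vec S M \<rho> s = \<rho> s \<and> ?e s = \<rho> s + g s - mat_vec S M g s"
    using stoch_decomposition[OF M, of ?e] by blast
  have "(\<lambda>N. (\<Sum>t<N. matpow S M t s x) / real N) \<longlonglongrightarrow> \<rho> s"
    using cesaro_tendsto[OF M dec s] by (simp only: matpow_entry[OF x, symmetric])
  then show ?thesis unfolding lim_mat_def clim_def by (simp add: limI)
qed

text \<open>Any decomposition of v reveals Q v as its harmonic part. Row sums, harmonic functions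
  and the invariance of Q are all read off from suitable decompositions.\<close>

lemma lim_mat_mat_vec:
  assumes M: "is_stoch S M"
    and v: "\<And>s. s < S \<Longrightarrow> mat_vec S M \<rho> s = \<rho> s \<and> v s = \<rho> s + g s - mat_vec S M g s"
    and s: "s < S"
  shows "mat_vec S (lim_mat S M) v s = \<rho> s"
proof -
  have "(\<lambda>N. \<Sum>x<S. (\<Sum>t<N. matpow S M t s x) / real N * v x) \<longlonglongrightarrow> (\<Sum>x<S. lim_mat S M s x * v x)"
    using lim_mat_tendsto[OF M s] by (intro tendsto_intros) auto
  moreover have "(\<Sum>x<S. (\<Sum>t<N. matpow S M t s x) / real N * v x)
      = (\<Sum>t<N. mat_vec S (matpow S M t) v s) / real N" for N
    unfolding mat_vec_def sum_divide_distrib sum_distrib_right by (subst sum.swap) simp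
  ultimately show ?thesis
    using LIMSEQ_unique[OF _ cesaro_tendsto[OF M v s]] by (simp add: mat_vec_def)
qed

lemma lim_mat_stoch: assumes M: "is_stoch S M" shows "is_stoch S (lim_mat S M)"
  unfolding is_stoch_def
proof (intro allI impI conjI)
  fix s x assume s: "s < S" and x: "x < S"
  have "0 \<le> (\<Sum>t<N. matpow S M t s x) / real N" for N
    using matpow_stoch[OF M] s x by (auto simp: is_stoch_def intro!: divide_nonneg_nonneg sum_nonneg)
  then show "0 \<le> lim_mat S M s x" using LIMSEQ_le_const[OF lim_mat_tendsto[OF M s x]] by blast
next
  fix s assume s: "s < S"
  have "mat_vec S (lim_mat S M) (\<lambda>_. 1) s = (\<lambda>_. 1) s"
    by (rule lim_mat_mat_vec[OF M _ s, where g = "\<lambda>_. 0"]) (simp add: mat_vec_const[OF M])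
  then show "(\<Sum>x<S. lim_mat S M s x) = 1" by (simp add: mat_vec_def)
qed

lemma lim_mat_harmonic:
  assumes M: "is_stoch S M" and "\<And>s. s < S \<Longrightarrow> mat_vec S M f s = f s" and s: "s < S"
  shows "mat_vec S (lim_mat S M) f s = f s"
  by (rule lim_mat_mat_vec[OF M _ s, where g = "\<lambda>_. 0"]) (use assms in \<open>simp add: mat_vec_const[OF M]\<close>)

lemma lim_mat_invariant:
  assumes M: "is_stoch S M" and s: "s < S"
  shows "mat_vec S (lim_mat S M) (mat_vec S M v) s = mat_vec S (lim_mat S M) v s" (is ?L)
    and "mat_vec S M (mat_vec S (lim_mat S M) v) s = mat_vec S (lim_mat S M) v s" (is ?R)
proof -
  obtain \<rho> g where dec: "\<And>s. s < S \<Longrightarrow> mat_vec S M \<rho> s = \<rho> s \<and> v s = \<rho> s + g s - mat_vec S M g s"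
    using stoch_decomposition[OF M, of v] by blast
  have Qv: "mat_vec S (lim_mat S M) v s = \<rho> s" if "s < S" for s
    using lim_mat_mat_vec[OF M dec that] .
  have "mat_vec S (lim_mat S M) (mat_vec S M v) s = \<rho> s"
  \<comment> \<open>Applying M to the decomposition of v preserves the harmonic part and replaces g
    by M g.\<close>
  proof (rule lim_mat_mat_vec[OF M _ s, where g = "mat_vec S M g"])
    fix s assume s: "s < S"
    have "mat_vec S M v s = mat_vec S M (\<lambda>s. (\<rho> s + g s) - mat_vec S M g s) s"
      using dec by (intro mat_vec_cong) blast
    then show "mat_vec S M \<rho> s = \<rho> s \<and> mat_vec S M v s = \<rho> s + mat_vec S M g s - mat_vec S M (mat_vec S M g) s"
      using dec[OF s] by (simp add: mat_vec_diff mat_vec_add)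
  qed
  then show ?L using Qv[OF s] by simp
  have "mat_vec S M (mat_vec S (lim_mat S M) v) s = mat_vec S M \<rho> s" using Qv by (rule mat_vec_cong)
  then show ?R using Qv[OF s] dec[OF s] by simp
qed

text \<open>The third claim fixes the freedom in the Poisson equation: h lies in the range of I - M,
  so its harmonic part is 0. This lets the expansion of the discounted value be carried one order
  further.\<close>

lemma gain_bias:
  fixes r :: "nat \<Rightarrow> nat \<Rightarrow> real"
  assumes P: "is_kernel S A P" and \<pi>: "is_policy S A \<pi>"
  defines "M \<equiv> P_pol A P \<pi>" and "\<rho> \<equiv> gain S A P r \<pi>" and "h \<equiv> bias S A P r \<pi>"
  shows "\<And>s. s < S \<Longrightarrow> mat_vec S M \<rho> s = \<rho> s"
    and "\<And>s. s < S \<Longrightarrow> r_pol A r \<pi> s = \<rho> s + h s - mat_vec S M h s"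
    and "\<exists>f. \<forall>s<S. h s = f s - mat_vec S M f s"
proof -
  note M = is_stoch_P_pol[OF P \<pi>, folded M_def]
  obtain \<rho>' g where r: "\<And>s. s < S \<Longrightarrow> mat_vec S M \<rho>' s = \<rho>' s \<and> r_pol A r \<pi> s = \<rho>' s + g s - mat_vec S M g s"
    using stoch_decomposition[OF M, of "r_pol A r \<pi>"] by blast
  obtain \<sigma> f where g: "\<And>s. s < S \<Longrightarrow> mat_vec S M \<sigma> s = \<sigma> s \<and> g s = \<sigma> s + f s - mat_vec S M f s"
    using stoch_decomposition[OF M, of g] by blast
  have \<rho>: "\<rho> s = \<rho>' s" if "s < S" for s
    unfolding \<rho>_def gain_def M_def[symmetric] by (rule lim_mat_mat_vec[OF M r that])
  \<comment> \<open>Removing the harmonic part \<sigma> of g leaves (I - M) g unchanged and puts k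
    into the range of I - M. The partial sums in the bias are k - M^T k, and the averages of M^T k
    then tend to 0.\<close>
  define k where "k s = g s - \<sigma> s" for s
  have k: "k s = f s - mat_vec S M f s" if "s < S" for s using g[OF that] by (simp add: k_def)
  have Mk: "mat_vec S M k s = mat_vec S M g s - \<sigma> s" if "s < S" for s
    using g[OF that] unfolding k_def mat_vec_diff by simp
  have r': "mat_vec S M \<rho>' s = \<rho>' s \<and> r_pol A r \<pi> s = \<rho>' s + k s - mat_vec S M k s" if "s < S" for s
    using r[OF that] Mk[OF that] by (simp add: k_def)
  have h: "h s = k s" if s: "s < S" for s
  proof -
    let ?T = "\<lambda>t. (mat_vec S M ^^ t) k s"
    have part: "(\<Sum>t<T. mat_vec S (matpow S M t) (r_pol A r \<pi>) s - \<rho> s)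
        = k s - mat_vec S (matpow S M T) k s" for T
    proof -
      have "(\<Sum>t<T. mat_vec S (matpow S M t) (r_pol A r \<pi>) s - \<rho> s) = (\<Sum>t<T. ?T t - ?T (Suc t))"
        using s by (simp add: matpow_mat_vec funpow_telescope[OF r' s] \<rho>[OF s] del: funpow.simps)
      also have "\<dots> = ?T 0 - ?T T" by (rule sum_lessThan_telescope')
      finally show ?thesis using s by (simp add: matpow_mat_vec)
    qed
    have "(\<lambda>N. (\<Sum>t<N. mat_vec S (matpow S M t) k s) / real N) \<longlonglongrightarrow> (\<lambda>_. 0) s"
      by (rule cesaro_tendsto[OF M _ s, where g = f]) (use k in \<open>simp add: mat_vec_const[OF M]\<close>)
    then have "(\<lambda>N. k s - (\<Sum>t<N. mat_vec S (matpow S M t) k s) / real N) \<longlonglongrightarrow> k s - 0"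
      by (intro tendsto_intros) auto
    moreover have "\<forall>\<^sub>F N in sequentially. k s - (\<Sum>t<N. mat_vec S (matpow S M t) k s) / real N
        = (\<Sum>T<N. k s - mat_vec S (matpow S M T) k s) / real N"
      using eventually_gt_at_top[of 0] by eventually_elim (simp add: sum_subtractf field_simps)
    ultimately have "(\<lambda>N. (\<Sum>T<N. k s - mat_vec S (matpow S M T) k s) / real N) \<longlonglongrightarrow> k s"
      by (simp add: tendsto_cong)
    then show ?thesis
      unfolding h_def bias_def M_def[symmetric] \<rho>_def[symmetric] part clim_def by (rule limI)
  qed
  show "mat_vec S M \<rho> s = \<rho> s" if "s < S" for s
    using mat_vec_cong[OF \<rho>, where M=M and s=s] r[OF that] \<rho>[OF that] by simp
  show "r_pol A r \<pi> s = \<rho> s + h s - mat_vec S M h s" if "s < S" for s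
    using mat_vec_cong[OF h, where M=M and s=s] r'[OF that] \<rho>[OF that] h[OF that] by simp
  show "\<exists>f. \<forall>s<S. h s = f s - mat_vec S M f s" using k h by auto
qed


section \<open>Blackwell optimal policies\<close>

lemma le_if_linear_error:
  fixes x :: real
  assumes "0 < b" "\<And>\<beta>. 0 < \<beta> \<Longrightarrow> \<beta> < b \<Longrightarrow> x \<le> y + c * \<beta>"
  shows "x \<le> y"
proof -
  have "((\<lambda>\<beta>. y + c * \<beta>) \<longlongrightarrow> y + c * 0) (at_right 0)" by (intro tendsto_intros)
  moreover have "\<forall>\<^sub>F \<beta> in at_right 0. x \<le> y + c * \<beta>"
    using eventually_at_right_less eventually_at_right_field[of _ 0] assms
    by (metis (no_types, lifting) eventually_at_right)
  ultimately show ?thesis using tendsto_lowerbound[of "\<lambda>\<beta>. y + c * \<beta>" _ "at_right 0" x] by simp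
qed

text \<open>With \<beta> = 1 - \<gamma> and k = M f one has M h = (I - M) k. Adding the corrector -
  \<beta> k to \<rho> / \<beta> + h therefore cancels the residual \<beta> M h in the discounted
  equation and leaves one of order \<beta>^2; solving the equation costs a factor 1 /
  \<beta>.\<close>

lemma disc_value_expansion:
  assumes P: "is_kernel S A P" and r: "is_reward S A r" and \<pi>: "is_policy S A \<pi>"
  shows "\<exists>K. \<forall>\<gamma> s. 0 \<le> \<gamma> \<longrightarrow> \<gamma> < 1 \<longrightarrow> s < S \<longrightarrow>
    \<bar>disc_value S A P r \<gamma> \<pi> s - (gain S A P r \<pi> s / (1 - \<gamma>) + bias S A P r \<pi> s)\<bar> \<le> K * (1 - \<gamma>)"
proof -
  let ?M = "P_pol A P \<pi>" and ?\<rho> = "gain S A P r \<pi>" and ?h = "bias S A P r \<pi>"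
  note M = is_stoch_P_pol[OF P \<pi>]
  obtain f where f: "\<forall>s<S. ?h s = f s - mat_vec S ?M f s" using gain_bias(3)[OF P \<pi>, of r] by blast
  define k where "k = mat_vec S ?M f"
  obtain B where B: "B \<ge> 0" "\<forall>s<S. \<bar>f s\<bar> \<le> B" using bound_exists by blast
  have kB: "\<bar>k s\<bar> \<le> B" if "s < S" for s unfolding k_def using B(2) by (intro mat_vec_stoch_bound[OF M that]) blast
  have MkB: "\<bar>mat_vec S ?M k s\<bar> \<le> B" if "s < S" for s using kB by (intro mat_vec_stoch_bound[OF M that]) blast
  have Mh: "mat_vec S ?M ?h s = k s - mat_vec S ?M k s" for s
  proof -
    have "mat_vec S ?M ?h s = mat_vec S ?M (\<lambda>s. f s - mat_vec S ?M f s) s"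
      using f by (intro mat_vec_cong) blast
    then show ?thesis by (simp only: k_def mat_vec_diff)
  qed
  have main: "\<bar>disc_value S A P r \<gamma> \<pi> s - (?\<rho> s / (1 - \<gamma>) + ?h s)\<bar> \<le> 2 * B * (1 - \<gamma>)"
    if \<gamma>: "0 \<le> \<gamma>" "\<gamma> < 1" and s: "s < S" for \<gamma> s
  proof -
    define \<beta> where "\<beta> = 1 - \<gamma>"
    have \<beta>: "0 < \<beta>" "\<gamma> = 1 - \<beta>" using \<gamma> by (auto simp: \<beta>_def)
    let ?V = "disc_value S A P r \<gamma> \<pi>"
    define e where "e s = ?V s - (inverse \<beta> * ?\<rho> s + ?h s) + \<beta> * k s" for s
    have e: "e s = \<gamma> * mat_vec S ?M e s + \<beta>\<^sup>2 * mat_vec S ?M k s" if s: "s < S" for s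
    proof -
      \<comment> \<open>The identity behind the corrector: i is 1 / \<beta>, p is \<rho> s, and u,
        w, n are the values at s of M V, M e, M k.\<close>
      have alg: "V - (i * p + h) + \<beta> * k = \<gamma> * w + \<beta>\<^sup>2 * n"
        if "V = p + h - (k - n) + \<gamma> * u" "w = u - (i * p + (k - n)) + \<beta> * n" "i * \<beta> = 1"
        for V i p h k w n u :: real
        using that \<beta>(2) by algebra
      have "mat_vec S ?M e s = mat_vec S ?M ?V s - (inverse \<beta> * ?\<rho> s + mat_vec S ?M ?h s) + \<beta> * mat_vec S ?M k s"
        unfolding e_def mat_vec_add mat_vec_diff mat_vec_scale gain_bias(1)[OF P \<pi> s] ..
      moreover have "?V s = ?\<rho> s + ?h s - mat_vec S ?M ?h s + \<gamma> * mat_vec S ?M ?V s"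
        using disc_value_eq[OF P r \<pi> \<gamma> s] gain_bias(2)[OF P \<pi> s, of r] by simp
      ultimately show ?thesis unfolding Mh
        by (subst e_def, intro alg[where u = "mat_vec S ?M ?V s"])
           (use \<beta>(1) in simp_all)
    qed
    have eB: "\<beta>\<^sup>2 * \<bar>mat_vec S ?M k s\<bar> \<le> \<beta>\<^sup>2 * B" if "s < S" for s
      using MkB[OF that] by (intro mult_left_mono) auto
    have abs_e: "\<beta>\<^sup>2 * \<bar>mat_vec S ?M k s\<bar> = \<bar>\<beta>\<^sup>2 * mat_vec S ?M k s\<bar>" for s by (simp add: abs_mult)
    have "e s \<le> \<beta>\<^sup>2 * B / (1 - \<gamma>)"
      using e eB abs_e by (intro stoch_discounted_le[OF M \<gamma> _ s]) (smt (verit))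
    moreover have "- e s \<le> \<beta>\<^sup>2 * B / (1 - \<gamma>)"
    proof (rule stoch_discounted_le[OF M \<gamma> _ s, where w = "\<lambda>s. - e s"])
      fix s assume s: "s < S"
      have "mat_vec S ?M (\<lambda>s. - e s) s = - mat_vec S ?M e s"
        using mat_vec_scale[of S ?M "-1" e s] by simp
      then show "- e s \<le> \<gamma> * mat_vec S ?M (\<lambda>s. - e s) s + \<beta>\<^sup>2 * B"
        using e[OF s] eB[OF s] abs_e[of s] by (smt (verit) mult_minus_right)
    qed
    ultimately have "\<bar>e s\<bar> \<le> \<beta> * B" using \<beta> by (simp add: power2_eq_square abs_le_iff)
    moreover have "\<bar>\<beta> * k s\<bar> \<le> \<beta> * B" using kB[OF s] \<beta> by (simp add: abs_mult)
    ultimately have "\<bar>e s - \<beta> * k s\<bar> \<le> 2 * (\<beta> * B)" by linarith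
    then show ?thesis by (simp add: e_def \<beta>_def divide_inverse mult_ac)
  qed
  show ?thesis by (rule exI[of _ "2 * B"]) (use main in blast)
qed

text \<open>The greedy policy of the Bellman solution is one of the competitors, so a policy that is
  optimal at \<gamma> has exactly the Bellman solution as its value.\<close>

lemma blackwell_bellman_ineq:
  assumes P: "is_kernel S A P" and r: "is_reward S A r" and "0 < A" and \<gamma>: "0 \<le> \<gamma>" "\<gamma> < 1"
    and \<pi>: "is_policy S A \<pi>"
    and opt: "\<And>\<pi>' s. is_policy S A \<pi>' \<Longrightarrow> s < S \<Longrightarrow> disc_value S A P r \<gamma> \<pi>' s \<le> disc_value S A P r \<gamma> \<pi> s"
    and s: "s < S" and a: "a < A"
  shows "r s a + \<gamma> * mat_vec S (\<lambda>x. P x a) (disc_value S A P r \<gamma> \<pi>) s \<le> disc_value S A P r \<gamma> \<pi> s"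
proof -
  obtain V where V: "bellman_sol S A P r \<gamma> V"
    using bellman_sol_exists[OF is_kernel_subkernel[OF P] \<gamma> \<open>0 < A\<close>, of r 1] r by (auto simp: is_reward_def)
  obtain \<pi>' where \<pi>': "is_policy S A \<pi>'" "\<And>s. s < S \<Longrightarrow> disc_value S A P r \<gamma> \<pi>' s = V s"
    using bellman_greedy[OF P r \<gamma> V] by blast
  have eq: "disc_value S A P r \<gamma> \<pi> s = V s" if "s < S" for s
    using opt[OF \<pi>'(1) that] \<pi>'(2)[OF that] disc_value_le_bellman[OF P r \<pi> \<gamma> V that] by simp
  have "mat_vec S (\<lambda>x. P x a) (disc_value S A P r \<gamma> \<pi>) s = mat_vec S (\<lambda>x. P x a) V s"
    using eq by (rule mat_vec_cong)
  then show ?thesis using V s a eq[OF s] by (simp add: bellman_sol_def)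
qed

lemma is_stoch_action: "is_kernel S A P \<Longrightarrow> a < A \<Longrightarrow> is_stoch S (\<lambda>x. P x a)"
  by (simp add: is_kernel_def is_stoch_def)

text \<open>The Bellman inequality holds on a whole interval of discount factors, so after inserting
  the expansion its orders in \<beta> can be compared: order 1 / \<beta> concerns the gain, order 1
  the bias.\<close>

lemma blackwell_expanded_ineq:
  assumes P: "is_kernel S A P" and r: "is_reward S A r" and "0 < A" and bw: "blackwell_optimal S A P r \<pi>"
  defines "\<rho> \<equiv> gain S A P r \<pi>" and "h \<equiv> bias S A P r \<pi>"
  obtains K b where "0 < b" "b \<le> 1" "0 \<le> K"
    "\<And>\<beta> s a. 0 < \<beta> \<Longrightarrow> \<beta> < b \<Longrightarrow> s < S \<Longrightarrow> a < A \<Longrightarrow>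
      r s a + (1 - \<beta>) * (mat_vec S (\<lambda>x. P x a) \<rho> s / \<beta> + mat_vec S (\<lambda>x. P x a) h s) \<le> \<rho> s / \<beta> + h s + K * \<beta>"
proof -
  have \<pi>: "is_policy S A \<pi>" using bw by (simp add: blackwell_optimal_def)
  obtain \<gamma>0 where \<gamma>0: "\<gamma>0 < 1" "\<And>\<gamma> \<pi>' s. \<gamma>0 < \<gamma> \<Longrightarrow> \<gamma> < 1 \<Longrightarrow> is_policy S A \<pi>' \<Longrightarrow> s < S \<Longrightarrow>
      disc_value S A P r \<gamma> \<pi>' s \<le> disc_value S A P r \<gamma> \<pi> s"
    using bw unfolding blackwell_optimal_def by blast
  obtain K where K: "\<And>\<gamma> s. 0 \<le> \<gamma> \<Longrightarrow> \<gamma> < 1 \<Longrightarrow> s < S \<Longrightarrow>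
      \<bar>disc_value S A P r \<gamma> \<pi> s - (\<rho> s / (1 - \<gamma>) + h s)\<bar> \<le> K * (1 - \<gamma>)"
    using disc_value_expansion[OF P r \<pi>] unfolding \<rho>_def h_def by blast
  show ?thesis
  \<comment> \<open>The choice of b keeps 1 - \<beta> nonnegative and above the Blackwell threshold.
    The expansion error enters once on each side, hence the factor 2.\<close>
  proof (rule that[of "min 1 (1 - \<gamma>0)" "2 * \<bar>K\<bar>"])
    fix \<beta> s a assume \<beta>: "0 < \<beta>" "\<beta> < min 1 (1 - \<gamma>0)" and s: "s < S" and a: "a < A"
    let ?V = "disc_value S A P r (1 - \<beta>) \<pi>" and ?w = "\<lambda>s. inverse \<beta> * \<rho> s + h s"
    have \<gamma>: "0 \<le> 1 - \<beta>" "1 - \<beta> < 1" "\<gamma>0 < 1 - \<beta>" using \<beta> by auto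
    have close: "\<bar>?V x - ?w x\<bar> \<le> \<bar>K\<bar> * \<beta>" if "x < S" for x
    proof -
      have "\<bar>?V x - ?w x\<bar> \<le> K * \<beta>" using K[OF \<gamma>(1,2) that] by (simp add: divide_inverse mult.commute)
      also have "\<dots> \<le> \<bar>K\<bar> * \<beta>" using \<beta> by (intro mult_right_mono) auto
      finally show ?thesis .
    qed
    have "\<bar>mat_vec S (\<lambda>x. P x a) (\<lambda>x. ?V x - ?w x) s\<bar> \<le> \<bar>K\<bar> * \<beta>"
      using close by (intro mat_vec_stoch_bound[OF is_stoch_action[OF P a] s]) blast
    then have "mat_vec S (\<lambda>x. P x a) ?w s - \<bar>K\<bar> * \<beta> \<le> mat_vec S (\<lambda>x. P x a) ?V s"
      unfolding mat_vec_diff by (simp add: abs_le_iff)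
    then have "(1 - \<beta>) * (mat_vec S (\<lambda>x. P x a) ?w s - \<bar>K\<bar> * \<beta>) \<le> (1 - \<beta>) * mat_vec S (\<lambda>x. P x a) ?V s"
      using \<gamma> by (intro mult_left_mono) auto
    moreover have "r s a + (1 - \<beta>) * mat_vec S (\<lambda>x. P x a) ?V s \<le> ?V s"
      by (rule blackwell_bellman_ineq[OF P r \<open>0 < A\<close> \<gamma>(1,2) \<pi> _ s a]) (use \<gamma>0(2) \<gamma> in blast)
    moreover have "?V s \<le> ?w s + \<bar>K\<bar> * \<beta>" using close[OF s] by (simp add: abs_le_iff)
    moreover have "(1 - \<beta>) * (\<bar>K\<bar> * \<beta>) \<le> 1 * (\<bar>K\<bar> * \<beta>)" using \<beta> by (intro mult_right_mono) auto
    ultimately have "r s a + (1 - \<beta>) * mat_vec S (\<lambda>x. P x a) ?w s \<le> ?w s + 2 * \<bar>K\<bar> * \<beta>"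
      by (simp add: right_diff_distrib)
    then show "r s a + (1 - \<beta>) * (mat_vec S (\<lambda>x. P x a) \<rho> s / \<beta> + mat_vec S (\<lambda>x. P x a) h s)
        \<le> \<rho> s / \<beta> + h s + 2 * \<bar>K\<bar> * \<beta>"
      by (simp add: mat_vec_add mat_vec_scale divide_inverse mult.commute)
  qed (use \<gamma>0 in auto)
qed

lemma blackwell_gain_superharmonic:
  assumes P: "is_kernel S A P" and r: "is_reward S A r" and "0 < A" and bw: "blackwell_optimal S A P r \<pi>"
    and s: "s < S" and a: "a < A"
  shows "mat_vec S (\<lambda>x. P x a) (gain S A P r \<pi>) s \<le> gain S A P r \<pi> s"
proof -
  let ?\<rho> = "gain S A P r \<pi>" and ?h = "bias S A P r \<pi>" and ?P = "mat_vec S (\<lambda>x. P x a)"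
  obtain K b where b: "0 < b" "b \<le> 1" "0 \<le> K"
    and ineq: "\<And>\<beta>. 0 < \<beta> \<Longrightarrow> \<beta> < b \<Longrightarrow> r s a + (1 - \<beta>) * (?P ?\<rho> s / \<beta> + ?P ?h s) \<le> ?\<rho> s / \<beta> + ?h s + K * \<beta>"
    using blackwell_expanded_ineq[OF P r \<open>0 < A\<close> bw] s a by metis
  show ?thesis
  \<comment> \<open>After multiplication by \<beta>, all that remains besides the two gain terms is
    \<beta> times a quantity that this sum bounds for \<beta> < 1.\<close>
  proof (rule le_if_linear_error[OF b(1), where c = "\<bar>?h s\<bar> + K + \<bar>?P ?\<rho> s\<bar> + \<bar>?P ?h s\<bar> + \<bar>r s a\<bar>"])
    fix \<beta> assume \<beta>: "0 < \<beta>" "\<beta> < b"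
    then have \<beta>1: "\<beta> < 1" using b by simp
    have mult: "\<beta> * (r s a + (1 - \<beta>) * (?P ?\<rho> s / \<beta> + ?P ?h s)) \<le> \<beta> * (?\<rho> s / \<beta> + ?h s + K * \<beta>)"
      using ineq[OF \<beta>] \<beta> by (intro mult_left_mono) auto
    then have "?P ?\<rho> s \<le> ?\<rho> s + \<beta> * (?h s + K * \<beta> + ?P ?\<rho> s - (1 - \<beta>) * ?P ?h s - r s a)"
    proof -
      have "\<beta> * (r s a + (1 - \<beta>) * (?P ?\<rho> s / \<beta> + ?P ?h s)) = \<beta> * r s a + ?P ?\<rho> s - \<beta> * ?P ?\<rho> s + \<beta> * ((1 - \<beta>) * ?P ?h s)"
        using \<beta>(1) by (simp add: field_simps)
      moreover have "\<beta> * (?\<rho> s / \<beta> + ?h s + K * \<beta>) = ?\<rho> s + \<beta> * ?h s + \<beta> * (K * \<beta>)"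
        using \<beta>(1) by (simp add: field_simps)
      ultimately have "\<beta> * r s a + ?P ?\<rho> s - \<beta> * ?P ?\<rho> s + \<beta> * ((1 - \<beta>) * ?P ?h s)
          \<le> ?\<rho> s + \<beta> * ?h s + \<beta> * (K * \<beta>)"
        using mult by simp
      then show ?thesis by (simp add: right_diff_distrib distrib_left)
    qed
    also have "\<dots> \<le> ?\<rho> s + \<beta> * (\<bar>?h s\<bar> + K + \<bar>?P ?\<rho> s\<bar> + \<bar>?P ?h s\<bar> + \<bar>r s a\<bar>)"
    proof -
      have "K * \<beta> \<le> K * 1" using b(3) \<beta>1 by (intro mult_left_mono) auto
      moreover have "\<bar>(1 - \<beta>) * ?P ?h s\<bar> \<le> 1 * \<bar>?P ?h s\<bar>"
        unfolding abs_mult using \<beta> \<beta>1 by (intro mult_right_mono) auto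
      ultimately have "?h s + K * \<beta> + ?P ?\<rho> s - (1 - \<beta>) * ?P ?h s - r s a
          \<le> \<bar>?h s\<bar> + K + \<bar>?P ?\<rho> s\<bar> + \<bar>?P ?h s\<bar> + \<bar>r s a\<bar>" by linarith
      then show ?thesis using \<beta>(1) by simp
    qed
    finally show "?P ?\<rho> s \<le> ?\<rho> s + (\<bar>?h s\<bar> + K + \<bar>?P ?\<rho> s\<bar> + \<bar>?P ?h s\<bar> + \<bar>r s a\<bar>) * \<beta>"
      by (simp add: mult.commute)
  qed
qed

text \<open>Constant gain makes the terms of order 1 / \<beta> cancel for every action, so the next
  order can be compared. An action that lowered the gain would have slack at order 1 / \<beta> and
  say nothing about the bias.\<close>

lemma blackwell_optimality_ineq:
  assumes P: "is_kernel S A P" and r: "is_reward S A r" and "0 < A" and bw: "blackwell_optimal S A P r \<pi>"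
    and const: "\<And>s. s < S \<Longrightarrow> gain S A P r \<pi> s = m"
    and s: "s < S" and a: "a < A"
  shows "r s a + mat_vec S (\<lambda>x. P x a) (bias S A P r \<pi>) s \<le> m + bias S A P r \<pi> s"
proof -
  let ?\<rho> = "gain S A P r \<pi>" and ?h = "bias S A P r \<pi>" and ?P = "mat_vec S (\<lambda>x. P x a)"
  obtain K b where b: "0 < b" "b \<le> 1" "0 \<le> K"
    and ineq: "\<And>\<beta>. 0 < \<beta> \<Longrightarrow> \<beta> < b \<Longrightarrow> r s a + (1 - \<beta>) * (?P ?\<rho> s / \<beta> + ?P ?h s) \<le> ?\<rho> s / \<beta> + ?h s + K * \<beta>"
    using blackwell_expanded_ineq[OF P r \<open>0 < A\<close> bw] s a by metis
  have "?P ?\<rho> s = ?P (\<lambda>_. m) s" using const by (rule mat_vec_cong)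
  then have Pm: "?P ?\<rho> s = m" using mat_vec_const[OF is_stoch_action[OF P a] s] by simp
  show ?thesis
  proof (rule le_if_linear_error[OF b(1), where c = "K + ?P ?h s"])
    fix \<beta> assume \<beta>: "0 < \<beta>" "\<beta> < b"
    have "(1 - \<beta>) * (m / \<beta>) = m / \<beta> - m" using \<beta> by (simp add: field_simps)
    then show "r s a + ?P ?h s \<le> m + ?h s + (K + ?P ?h s) * \<beta>"
      using ineq[OF \<beta>] unfolding Pm const[OF s] by (simp add: algebra_simps)
  qed
qed

section \<open>Constancy of the optimal gain\<close>

text \<open>An average of values >= m that is itself <= m cannot charge a point where f > m. This
  carries the minimum of a superharmonic function along every transition of positive
  probability.\<close>

lemma stoch_min_support:
  assumes N: "is_stoch S N" and x: "x < S" and le: "mat_vec S N f x \<le> m"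
    and min: "\<And>y. y < S \<Longrightarrow> m \<le> f y" and y: "y < S" and pos: "0 < N x y"
  shows "f y = m"
proof -
  have nn: "0 \<le> N x z * (f z - m)" if "z < S" for z
    using N x min that by (simp add: is_stoch_def)
  have "(\<Sum>z<S. N x z * (f z - m)) = mat_vec S N f x - mat_vec S N (\<lambda>_. m) x"
    by (simp add: mat_vec_def right_diff_distrib sum_subtractf)
  also have "\<dots> \<le> 0" using le mat_vec_const[OF N x] by simp
  finally have "(\<Sum>z<S. N x z * (f z - m)) = 0" using nn by (intro antisym sum_nonneg) auto
  then have "N x y * (f y - m) = 0" using nn y by (subst (asm) sum_nonneg_eq_0_iff) auto
  then show ?thesis using pos by simp
qed

lemma superharmonic_funpow:
  assumes M: "is_stoch S M" and f: "\<And>s. s < S \<Longrightarrow> mat_vec S M f s \<le> f s" and s: "s < S"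
  shows "mat_vec S (matpow S M t) f s \<le> f s"
  using s
proof (induction t arbitrary: s)
  case 0
  then show ?case by (simp add: matpow_mat_vec del: matpow.simps)
next
  case (Suc t)
  have "mat_vec S (matpow S M (Suc t)) f s = mat_vec S M ((mat_vec S M ^^ t) f) s"
    by (simp only: matpow_mat_vec[OF Suc.prems]) simp
  also have "\<dots> = mat_vec S M (mat_vec S (matpow S M t) f) s"
    by (intro mat_vec_cong) (simp add: matpow_mat_vec)
  also have "\<dots> \<le> mat_vec S M f s" using Suc.IH by (rule mat_vec_stoch_mono[OF M Suc.prems])
  also have "\<dots> \<le> f s" using f Suc.prems .
  finally show ?case .
qed

lemma transient_lim_mat_diag:
  assumes M: "is_stoch S M" and z: "z < S" and tr: "transient S M z"
  shows "lim_mat S M z z = 0"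
proof -
  let ?f = "\<lambda>t. matpow S M t z z"
  have nn: "0 \<le> ?f t" for t using matpow_stoch[OF M, of t] z by (simp add: is_stoch_def)
  have "(\<lambda>N. (\<Sum>t<N. ?f t) * (1 / real N)) \<longlonglongrightarrow> suminf ?f * 0"
    using tr unfolding transient_def
    by (intro tendsto_mult summable_LIMSEQ lim_const_over_n)
  then show ?thesis using LIMSEQ_unique[OF lim_mat_tendsto[OF M z z]] by simp
qed

text \<open>The column Q(., z) is invariant under Q. At a state where it is maximal and positive, z
  lies in the support of the row, so Q(z, z) equals that maximum, although it is 0 by transience.
  The sign change in q turns the maximum into a minimum.\<close>

lemma transient_lim_mat_column:
  assumes M: "is_stoch S M" and z: "z < S" and tr: "transient S M z" and s: "s < S"
  shows "lim_mat S M s z = 0"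
proof -
  let ?Q = "lim_mat S M"
  define q where "q x = - ?Q x z" for x
  note Q = lim_mat_stoch[OF M]
  let ?e = "\<lambda>y. if y = z then 1 else 0 :: real"
  have Qe: "mat_vec S ?Q ?e x = ?Q x z" for x
  proof -
    have "mat_vec S ?Q ?e x = (\<Sum>y<S. if y = z then ?Q x y else 0)"
      unfolding mat_vec_def by (intro sum.cong) auto
    then show ?thesis using z by simp
  qed
  have "mat_vec S M (\<lambda>x. ?Q x z) x = ?Q x z" if "x < S" for x
    using lim_mat_invariant(2)[OF M that, of ?e] unfolding Qe[abs_def] .
  then have "mat_vec S ?Q (\<lambda>x. ?Q x z) x = ?Q x z" if "x < S" for x
    using lim_mat_harmonic[OF M _ that] by blast
  then have Qq: "mat_vec S ?Q q x = q x" if "x < S" for x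
    using that mat_vec_scale[of S ?Q "-1" "\<lambda>x. ?Q x z" x] by (simp add: q_def[abs_def])
  define m where "m = Min (q ` {..<S})"
  have "m \<in> q ` {..<S}" unfolding m_def using s by (intro Min_in) auto
  then obtain y where y: "y < S" "q y = m" by auto
  have min: "m \<le> q x" if "x < S" for x using that by (simp add: m_def)
  have "m = 0"
  proof (rule ccontr)
    assume "m \<noteq> 0"
    moreover have "0 \<le> ?Q y z" using y Q z by (simp add: is_stoch_def)
    ultimately have "0 < ?Q y z" using y(2) by (simp add: q_def)
    then have "q z = m" using stoch_min_support[OF Q y(1), of q m z] min z Qq[OF y(1)] y(2) by simp
    then show False using transient_lim_mat_diag[OF M z tr] \<open>m \<noteq> 0\<close> by (simp add: q_def)
  qed
  then show ?thesis using min[OF s] Q s z by (auto simp: q_def is_stoch_def intro: antisym)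
qed

text \<open>The limit matrix of the Blackwell policy charges only the communicating set R, so the
  minimum of \<rho> = Q \<rho> is attained at some y in R. Reaching the rest of R may take other
  policies; \<rho> is superharmonic under all of them, so the minimum spreads over R, and averaging
  by Q extends it to every state.\<close>

lemma blackwell_gain_const:
  assumes P: "is_kernel S A P" and r: "is_reward S A r" and "0 < A" and bw: "blackwell_optimal S A P r \<pi>"
    and wc: "weakly_communicating S A P"
  obtains m where "\<And>s. s < S \<Longrightarrow> gain S A P r \<pi> s = m"
proof (cases "S = 0")
  case True
  then show ?thesis using that by simp
next
  case False
  let ?\<rho> = "gain S A P r \<pi>"
  have \<pi>: "is_policy S A \<pi>" using bw by (simp add: blackwell_optimal_def)
  note M = is_stoch_P_pol[OF P \<pi>] and harm = gain_bias(1)[OF P \<pi>, of _ r]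
  let ?Q = "lim_mat S (P_pol A P \<pi>)"
  note Q = lim_mat_stoch[OF M]
  obtain R where R: "R \<subseteq> {..<S}" "\<And>x y. x \<in> R \<Longrightarrow> y \<in> R \<Longrightarrow> reachable S A P x y"
    "\<And>z \<pi>. z < S \<Longrightarrow> z \<notin> R \<Longrightarrow> is_policy S A \<pi> \<Longrightarrow> transient S (P_pol A P \<pi>) z"
    using wc unfolding weakly_communicating_def by blast
  have QR: "?Q s z = 0" if "s < S" "z < S" "z \<notin> R" for s z
    using transient_lim_mat_column[OF M that(2) R(3)[OF that(2,3) \<pi>] that(1)] .
  have QP: "mat_vec S ?Q ?\<rho> s = ?\<rho> s" if "s < S" for s using lim_mat_harmonic[OF M harm that] .
  define m where "m = Min (?\<rho> ` {..<S})"
  have "m \<in> ?\<rho> ` {..<S}" unfolding m_def using False by (intro Min_in) auto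
  then obtain x where x: "x < S" "?\<rho> x = m" by auto
  have min: "m \<le> ?\<rho> y" if "y < S" for y using that by (simp add: m_def)
  obtain y where y: "y < S" "0 < ?Q x y"
  proof -
    have "(\<Sum>y<S. ?Q x y) \<noteq> 0" using Q x by (simp add: is_stoch_def)
    then obtain y where "y < S" "?Q x y \<noteq> 0" by (metis lessThan_iff sum.neutral)
    then show ?thesis using that Q x by (auto simp: is_stoch_def order_le_less)
  qed
  have yR: "y \<in> R" using QR[OF x(1) y(1)] y(2) by auto
  have \<rho>y: "?\<rho> y = m" using stoch_min_support[OF Q x(1), of ?\<rho> m y] min y QP[OF x(1)] x(2) by simp
  have onR: "?\<rho> z = m" if "z \<in> R" for z
  proof -
    have zS: "z < S" using that R(1) by auto
    have "reachable S A P y z" using R(2)[OF yR that] .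
    then obtain \<pi>' t where \<pi>': "is_policy S A \<pi>'" "0 < matpow S (P_pol A P \<pi>') t y z"
      unfolding reachable_def by blast
    note M' = is_stoch_P_pol[OF P \<pi>'(1)]
    have "mat_vec S (P_pol A P \<pi>') ?\<rho> s \<le> ?\<rho> s" if "s < S" for s
      unfolding mat_vec_P_pol using blackwell_gain_superharmonic[OF P r \<open>0 < A\<close> bw that]
      by (intro sum_policy_le[OF \<pi>'(1) that])
    then have "mat_vec S (matpow S (P_pol A P \<pi>') t) ?\<rho> y \<le> m"
      using superharmonic_funpow[OF M' _ y(1), of ?\<rho> t] \<rho>y by simp
    then show ?thesis using stoch_min_support[OF matpow_stoch[OF M'] y(1), of t ?\<rho> m z] min zS \<pi>'(2) by simp
  qed
  have "?\<rho> s = m" if s: "s < S" for s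
  proof -
    have "?\<rho> s = (\<Sum>y<S. ?Q s y * ?\<rho> y)" using QP[OF s] by (simp add: mat_vec_def)
    also have "\<dots> = (\<Sum>y<S. ?Q s y * m)"
      using QR[OF s] onR by (intro sum.cong refl) (metis lessThan_iff mult_zero_left)
    also have "\<dots> = m" using mat_vec_const[OF Q s, of m] by (simp add: mat_vec_def)
    finally show ?thesis .
  qed
  then show ?thesis by (rule that)
qed


section \<open>Concentration of the empirical kernel\<close>

lemma measure_pmf_mono_support:
  "(\<And>x. x \<in> set_pmf p \<Longrightarrow> x \<in> X \<Longrightarrow> x \<in> Y) \<Longrightarrow> measure_pmf.prob p X \<le> measure_pmf.prob p Y"
  by (subst measure_Int_set_pmf[of p X, symmetric]) (auto intro: measure_pmf.finite_measure_mono)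

text \<open>Scaling the threshold by b - a frees the bound from the range. The strict inequality in
  the event matters when a = b: f is then constant on the support and the event is null, while
  Hoeffding's inequality is invoked only for a < b.\<close>

lemma hoeffding_Pi_pmf:
  fixes f :: "'b \<Rightarrow> real" and \<epsilon> :: real
  assumes J: "finite J" "J \<noteq> {}" and f: "\<And>x. x \<in> set_pmf q \<Longrightarrow> a \<le> f x \<and> f x \<le> b"
    and p: "\<And>j. j \<in> J \<Longrightarrow> p j = q" and \<epsilon>: "0 \<le> \<epsilon>"
  shows "measure_pmf.prob (Pi_pmf J d p)
      {\<omega>. \<epsilon> * (b - a) < \<bar>(\<Sum>j\<in>J. f (\<omega> j)) / card J - measure_pmf.expectation q f\<bar>}
    \<le> 2 * exp (- 2 * card J * \<epsilon>\<^sup>2)"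
proof -
  let ?M = "Pi_pmf J d p" and ?N = "real (card J)"
  have N: "?N > 0" using J by (simp add: card_gt_0_iff)
  have supp: "\<omega> j \<in> set_pmf q" if "\<omega> \<in> set_pmf ?M" "j \<in> J" for \<omega> j
    using that set_Pi_pmf_subset'[OF J(1), of d p] p by (auto simp: PiE_dflt_def)
  show ?thesis
  proof (cases "a < b")
    case True
    interpret Hoeffding_ineq "measure_pmf ?M" J "\<lambda>j \<omega>. f (\<omega> j)" "\<lambda>_. a" "\<lambda>_. b"
      "\<Sum>j\<in>J. measure_pmf.expectation ?M (\<lambda>\<omega>. f (\<omega> j))"
    proof unfold_locales
      show "prob_space.indep_vars (measure_pmf ?M) (\<lambda>_. borel) (\<lambda>j \<omega>. f (\<omega> j)) J"
        by (rule prob_space.indep_vars_compose2[OF measure_pmf.prob_space_axioms indep_vars_Pi_pmf[OF J(1)]]) simp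
      show "AE \<omega> in measure_pmf ?M. f (\<omega> j) \<in> {a..b}" if "j \<in> J" for j
        using supp[OF _ that] f by (auto simp: AE_measure_pmf_iff)
    qed (use J in auto)
    have E: "measure_pmf.expectation ?M (\<lambda>\<omega>. f (\<omega> j)) = measure_pmf.expectation q f" if "j \<in> J" for j
    proof -
      have "measure_pmf.expectation q f = measure_pmf.expectation (map_pmf (\<lambda>\<omega>. \<omega> j) ?M) f"
        using that p by (simp only: Pi_pmf_component[OF J(1)] if_True)
      then show ?thesis by (simp add: integral_map_pmf)
    qed
    have "measure_pmf.prob ?M {\<omega>. \<epsilon> * (b - a) < \<bar>(\<Sum>j\<in>J. f (\<omega> j)) / ?N - measure_pmf.expectation q f\<bar>}
        \<le> measure_pmf.prob ?M {\<omega> \<in> space (measure_pmf ?M). \<epsilon> * (b - a) * ?N \<le> \<bar>(\<Sum>j\<in>J. f (\<omega> j)) - (\<Sum>j\<in>J. measure_pmf.expectation ?M (\<lambda>\<omega>. f (\<omega> j)))\<bar>}"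
    proof (intro measure_pmf.finite_measure_mono subsetI)
      fix \<omega> assume "\<omega> \<in> {\<omega>. \<epsilon> * (b - a) < \<bar>(\<Sum>j\<in>J. f (\<omega> j)) / ?N - measure_pmf.expectation q f\<bar>}"
      then have "\<epsilon> * (b - a) * ?N \<le> \<bar>(\<Sum>j\<in>J. f (\<omega> j)) / ?N - measure_pmf.expectation q f\<bar> * ?N"
        using N by (intro mult_right_mono) auto
      also have "\<dots> = \<bar>((\<Sum>j\<in>J. f (\<omega> j)) / ?N - measure_pmf.expectation q f) * ?N\<bar>" by (simp add: abs_mult)
      also have "((\<Sum>j\<in>J. f (\<omega> j)) / ?N - measure_pmf.expectation q f) * ?N
          = (\<Sum>j\<in>J. f (\<omega> j)) - (\<Sum>j\<in>J. measure_pmf.expectation ?M (\<lambda>\<omega>. f (\<omega> j)))"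
        using N E by (simp add: field_simps)
      finally show "\<omega> \<in> {\<omega> \<in> space (measure_pmf ?M). \<epsilon> * (b - a) * ?N \<le> \<bar>(\<Sum>j\<in>J. f (\<omega> j)) - (\<Sum>j\<in>J. measure_pmf.expectation ?M (\<lambda>\<omega>. f (\<omega> j)))\<bar>}"
        by simp
    qed simp
    also have "\<dots> \<le> 2 * exp (- 2 * (\<epsilon> * (b - a) * ?N)\<^sup>2 / (\<Sum>j\<in>J. (b - a)\<^sup>2))"
      by (rule Hoeffding_ineq_abs_ge) (use \<epsilon> True N in auto)
    also have "- 2 * (\<epsilon> * (b - a) * ?N)\<^sup>2 / (\<Sum>j\<in>J. (b - a)\<^sup>2) = - 2 * card J * \<epsilon>\<^sup>2"
    proof -
      have "- 2 * (\<epsilon> * e * ?N)\<^sup>2 / (?N * e\<^sup>2) = - 2 * ?N * \<epsilon>\<^sup>2" if "0 < e" for e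
        using that N by (simp add: field_simps power2_eq_square)
      from this[of "b - a"] True show ?thesis by simp
    qed
    finally show ?thesis .
  next
    case False
    obtain x where "x \<in> set_pmf q" using set_pmf_not_empty[of q] by blast
    then have ab: "a = b" using f[of x] False by simp
    then have fa: "f x = a" if "x \<in> set_pmf q" for x using f[OF that] by simp
    have "measure_pmf.expectation q f = measure_pmf.expectation q (\<lambda>_. a)"
      by (intro integral_cong_AE) (use fa in \<open>auto simp: AE_measure_pmf_iff\<close>)
    then have Ea: "measure_pmf.expectation q f = a" by simp
    have "measure_pmf.prob ?M {\<omega>. \<epsilon> * (b - a) < \<bar>(\<Sum>j\<in>J. f (\<omega> j)) / ?N - measure_pmf.expectation q f\<bar>}
        \<le> measure_pmf.prob ?M {}"
      by (rule measure_pmf_mono_support) (use ab Ea N supp fa in auto)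
    then show ?thesis by (simp add: order_trans)
  qed
qed

text \<open>Fubini: the coordinates outside J are frozen at g, and a bound uniform in g survives the
  integration over g.\<close>

lemma prob_Pi_pmf_conditional:
  assumes I: "finite I" "J \<subseteq> I"
    and le: "\<And>g. measure_pmf.prob (Pi_pmf J d p) {h. Q (\<lambda>x. if x \<in> I - J then g x else h x)} \<le> c"
  shows "measure_pmf.prob (Pi_pmf I d p) {\<omega>. Q \<omega>} \<le> c"
proof -
  let ?A = "Pi_pmf (I - J) d p" and ?B = "Pi_pmf J d p"
  have "0 \<le> c" using le measure_nonneg order_trans by blast
  have fin: "finite J" using I finite_subset by blast
  have eq: "Pi_pmf I d p = map_pmf (\<lambda>(g, h) x. if x \<in> I - J then g x else h x) (pair_pmf ?A ?B)"
    using Pi_pmf_union[OF _ fin, of "I - J" d p] I by (simp add: Un_absorb2 Diff_disjoint Int_commute)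
  have "emeasure (Pi_pmf I d p) {\<omega>. Q \<omega>}
      = emeasure (pair_pmf ?A ?B) {(g, h). Q (\<lambda>x. if x \<in> I - J then g x else h x)}"
    unfolding eq by (simp add: vimage_def case_prod_unfold)
  also have "\<dots> = (\<integral>\<^sup>+z. indicator {(g, h). Q (\<lambda>x. if x \<in> I - J then g x else h x)} z \<partial>pair_pmf ?A ?B)"
    by simp
  also have "\<dots> = (\<integral>\<^sup>+g. \<integral>\<^sup>+h. indicator {h. Q (\<lambda>x. if x \<in> I - J then g x else h x)} h \<partial>?B \<partial>?A)"
    unfolding nn_integral_pair_pmf' by (simp add: indicator_def)
  also have "\<dots> = (\<integral>\<^sup>+g. emeasure ?B {h. Q (\<lambda>x. if x \<in> I - J then g x else h x)} \<partial>?A)"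
    by simp
  also have "\<dots> \<le> (\<integral>\<^sup>+g. ennreal c \<partial>?A)"
    using le by (intro nn_integral_mono) (simp add: measure_pmf.emeasure_eq_measure ennreal_leI)
  also have "\<dots> = ennreal c" by simp
  finally show ?thesis using \<open>0 \<le> c\<close> by (simp add: measure_pmf.emeasure_eq_measure)
qed

text \<open>\<open>is_kernel\<close> normalizes the mass on \<open>{..<S}\<close> only; cutting the
  row off there makes the total mass 1, which gives \<open>embed_pmf\<close> its meaning.\<close>

lemma kernel_row_pmf:
  assumes P: "is_kernel S A P" and s: "s < S" and a: "a < A"
  defines "q \<equiv> embed_pmf (\<lambda>x. if x < S then P s a x else 0)"
  shows "set_pmf q \<subseteq> {..<S}" and "measure_pmf.expectation q f = mat_vec S (\<lambda>x. P x a) f s"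
proof -
  let ?f = "\<lambda>x. if x < S then P s a x else 0"
  have nn: "0 \<le> ?f x" for x using P s a by (simp add: is_kernel_def)
  have "(\<integral>\<^sup>+x. ennreal (?f x) \<partial>count_space UNIV) = (\<Sum>x<S. ennreal (?f x))"
    by (rule nn_integral_count_space') auto
  also have "\<dots> = ennreal (\<Sum>x<S. ?f x)" by (rule sum_ennreal) (rule nn)
  also have "(\<Sum>x<S. ?f x) = 1" using P s a by (simp add: is_kernel_def)
  finally have one: "(\<integral>\<^sup>+x. ennreal (?f x) \<partial>count_space UNIV) = 1" by simp
  show sub: "set_pmf q \<subseteq> {..<S}" unfolding q_def set_embed_pmf[OF nn one] by auto
  have "measure_pmf.expectation q f = (\<Sum>x<S. pmf q x *\<^sub>R f x)"
    by (rule integral_measure_pmf) (use sub in auto)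
  then show "measure_pmf.expectation q f = mat_vec S (\<lambda>x. P x a) f s"
    unfolding q_def pmf_embed_pmf[OF nn one] by (simp add: mat_vec_def)
qed

lemma emp_kernel_mat_vec:
  assumes "\<And>i. i < n \<Longrightarrow> \<omega> (s, a, i) < S"
  shows "mat_vec S (\<lambda>x. emp_kernel n \<omega> x a) f s = (\<Sum>i<n. f (\<omega> (s, a, i))) / n"
proof -
  have card: "real (card {i. i < n \<and> \<omega> (s, a, i) = x}) = (\<Sum>i<n. if \<omega> (s, a, i) = x then 1 else 0)" for x
  proof -
    have "{i. i < n \<and> \<omega> (s, a, i) = x} = {..<n} \<inter> {i. \<omega> (s, a, i) = x}" by auto
    then show ?thesis by (simp add: sum.If_cases)
  qed
  have "mat_vec S (\<lambda>x. emp_kernel n \<omega> x a) f s = (\<Sum>x<S. \<Sum>i<n. (if \<omega> (s, a, i) = x then 1 else 0) * f x / n)"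
    unfolding mat_vec_def emp_kernel_def card by (simp add: sum_distrib_right sum_divide_distrib)
  also have "\<dots> = (\<Sum>i<n. \<Sum>x<S. if \<omega> (s, a, i) = x then f x / n else 0)"
    by (subst sum.swap) (intro sum.cong refl, simp)
  also have "\<dots> = (\<Sum>i<n. f (\<omega> (s, a, i)) / n)"
    using assms by (intro sum.cong refl) simp
  finally show ?thesis by (simp add: sum_divide_distrib)
qed

lemma sample_support:
  assumes P: "is_kernel S A P" and \<omega>: "\<omega> \<in> set_pmf (sample_pmf S A P n)" and "s < S" "a < A" "i < n"
  shows "\<omega> (s, a, i) < S"
proof -
  have "\<omega> (s, a, i) \<in> set_pmf (embed_pmf (\<lambda>x. if x < S then P s a x else 0))"
    using \<omega> set_Pi_pmf_subset'[of "{..<S} \<times> {..<A} \<times> {..<n}"] assms(3-)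
    unfolding sample_pmf_def by (fastforce simp: PiE_dflt_def)
  then show ?thesis using kernel_row_pmf(1)[OF P \<open>s < S\<close> \<open>a < A\<close>] by auto
qed

lemma emp_kernel_is_kernel:
  assumes "\<And>s a i. s < S \<Longrightarrow> a < A \<Longrightarrow> i < n \<Longrightarrow> \<omega> (s, a, i) < S" "0 < n"
  shows "is_kernel S A (emp_kernel n \<omega>)"
  unfolding is_kernel_def
proof (intro allI impI conjI)
  fix s a assume "s < S" "a < A"
  have "(\<Sum>x<S. emp_kernel n \<omega> s a x) = mat_vec S (\<lambda>x. emp_kernel n \<omega> x a) (\<lambda>_. 1) s"
    by (simp add: mat_vec_def)
  also have "\<dots> = 1" using assms \<open>s < S\<close> \<open>a < A\<close> by (subst emp_kernel_mat_vec) auto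
  finally show "(\<Sum>x<S. emp_kernel n \<omega> s a x) = 1" .
qed (simp add: emp_kernel_def)

lemma deviation_prob:
  assumes P: "is_kernel S A P" and s: "s < S" and a: "a < A" and n: "0 < n" and \<epsilon>: "0 \<le> \<epsilon>"
    and V: "\<And>\<omega> \<omega>'. (\<And>x b i. x < S \<Longrightarrow> b < A \<Longrightarrow> i < n \<Longrightarrow> (x, b) \<noteq> (s, a) \<Longrightarrow> \<omega> (x, b, i) = \<omega>' (x, b, i))
        \<Longrightarrow> V \<omega> = V \<omega>'"
  shows "measure_pmf.prob (sample_pmf S A P n) {\<omega>. \<epsilon> * span_sp S (V \<omega>)
      < \<bar>mat_vec S (\<lambda>x. emp_kernel n \<omega> x a) (V \<omega>) s - mat_vec S (\<lambda>x. P x a) (V \<omega>) s\<bar>}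
    \<le> 2 * exp (- 2 * real n * \<epsilon>\<^sup>2)"
  unfolding sample_pmf_def
proof (rule prob_Pi_pmf_conditional[where J = "{s} \<times> {a} \<times> {..<n}"])
  let ?I = "{..<S} \<times> {..<A} \<times> {..<n}" and ?J = "{s} \<times> {a} \<times> {..<n}"
  show "finite ?I" "?J \<subseteq> ?I" using s a by auto
  fix g :: "nat \<times> nat \<times> nat \<Rightarrow> nat"
  let ?m = "\<lambda>h x. if x \<in> ?I - ?J then g x else h x"
  let ?p = "\<lambda>(s, a, i). embed_pmf (\<lambda>s'. if s' < S then P s a s' else 0)"
  let ?q = "embed_pmf (\<lambda>s'. if s' < S then P s a s' else 0)"
  define v where "v = V (?m (\<lambda>_. 0))"
  have Vv: "V (?m h) = v" for h unfolding v_def by (rule V) auto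
  have q: "set_pmf ?q \<subseteq> {..<S}" by (rule kernel_row_pmf(1)[OF P s a])
  have sumJ: "(\<Sum>j\<in>?J. f j) = (\<Sum>i<n. f (s, a, i))" for f :: "_ \<Rightarrow> real"
    by (rule sum.reindex_bij_witness[of _ "\<lambda>i. (s, a, i)" "\<lambda>j. snd (snd j)"]) auto
  have "measure_pmf.prob (Pi_pmf ?J 0 ?p) {h. \<epsilon> * span_sp S (V (?m h))
      < \<bar>mat_vec S (\<lambda>x. emp_kernel n (?m h) x a) (V (?m h)) s - mat_vec S (\<lambda>x. P x a) (V (?m h)) s\<bar>}
    \<le> measure_pmf.prob (Pi_pmf ?J 0 ?p) {h. \<epsilon> * (Max (v ` {..<S}) - Min (v ` {..<S}))
      < \<bar>(\<Sum>j\<in>?J. v (h j)) / card ?J - measure_pmf.expectation ?q v\<bar>}"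
  proof (rule measure_pmf_mono_support)
    fix h assume h: "h \<in> set_pmf (Pi_pmf ?J 0 ?p)"
      and ev: "h \<in> {h. \<epsilon> * span_sp S (V (?m h))
      < \<bar>mat_vec S (\<lambda>x. emp_kernel n (?m h) x a) (V (?m h)) s - mat_vec S (\<lambda>x. P x a) (V (?m h)) s\<bar>}"
    have hS: "?m h (s, a, i) < S" if "i < n" for i
    proof -
      have "h (s, a, i) \<in> set_pmf ?q"
        using h set_Pi_pmf_subset'[of ?J 0 ?p] that by (fastforce simp: PiE_dflt_def)
      then show ?thesis using q by auto
    qed
    have "mat_vec S (\<lambda>x. emp_kernel n (?m h) x a) v s = (\<Sum>i<n. v (?m h (s, a, i))) / n"
      by (rule emp_kernel_mat_vec) (rule hS)
    then have "mat_vec S (\<lambda>x. emp_kernel n (?m h) x a) v s = (\<Sum>j\<in>?J. v (h j)) / card ?J"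
      unfolding sumJ by simp
    then show "h \<in> {h. \<epsilon> * (Max (v ` {..<S}) - Min (v ` {..<S}))
        < \<bar>(\<Sum>j\<in>?J. v (h j)) / card ?J - measure_pmf.expectation ?q v\<bar>}"
      using ev unfolding Vv span_sp_def kernel_row_pmf(2)[OF P s a] by simp
  qed
  also have "\<dots> \<le> 2 * exp (- 2 * card ?J * \<epsilon>\<^sup>2)"
  proof (rule hoeffding_Pi_pmf[OF _ _ _ _ \<epsilon>])
    show "Min (v ` {..<S}) \<le> v x \<and> v x \<le> Max (v ` {..<S})" if "x \<in> set_pmf ?q" for x
      using that q by auto
  qed (use n in auto)
  finally show "measure_pmf.prob (Pi_pmf ?J 0 ?p) {h. \<epsilon> * span_sp S (V (?m h))
      < \<bar>mat_vec S (\<lambda>x. emp_kernel n (?m h) x a) (V (?m h)) s - mat_vec S (\<lambda>x. P x a) (V (?m h)) s\<bar>}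
    \<le> 2 * exp (- 2 * real n * \<epsilon>\<^sup>2)"
    by simp
qed

text \<open>Leave-one-out value: it does not depend on the row \<open>(s0, a0)\<close> of \<open>K\<close>, and it is the fixed point \<open>V\<close> of
  the original Bellman equation when \<open>u = r s0 a0 + \<gamma> (K V) s0 a0\<close>.\<close>

definition loo_value where
  "loo_value S A K r \<gamma> s0 a0 u = (SOME V. bellman_sol S A
     (\<lambda>s a x. if (s, a) = (s0, a0) then 0 else K s a x) (\<lambda>s a. if (s, a) = (s0, a0) then u else r s a) \<gamma> V)"

lemma mat_vec_row_cong: "(\<And>x. x < S \<Longrightarrow> M s x = N s x) \<Longrightarrow> mat_vec S M v s = mat_vec S N v s"
  by (simp add: mat_vec_def)

lemma bellman_sol_cong:
  assumes "\<And>s a x. s < S \<Longrightarrow> a < A \<Longrightarrow> x < S \<Longrightarrow> K s a x = K' s a x"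
  shows "bellman_sol S A K R \<gamma> V = bellman_sol S A K' R \<gamma> V"
proof -
  have "mat_vec S (\<lambda>x. K x a) V s = mat_vec S (\<lambda>x. K' x a) V s" if "s < S" "a < A" for s a
    using assms that by (intro mat_vec_row_cong) auto
  then show ?thesis by (simp add: bellman_sol_def cong: conj_cong)
qed

text \<open>The two Bellman predicates are equal, so \<open>SOME\<close> selects the same V. The
  value is thus literally independent of the samples at (s0, a0), as the conditioning argument
  demands.\<close>

lemma loo_value_cong:
  assumes "\<And>s a x. s < S \<Longrightarrow> a < A \<Longrightarrow> (s, a) \<noteq> (s0, a0) \<Longrightarrow> K s a x = K' s a x"
  shows "loo_value S A K r \<gamma> s0 a0 u = loo_value S A K' r \<gamma> s0 a0 u"
proof -
  have "bellman_sol S A (\<lambda>s a x. if (s, a) = (s0, a0) then 0 else K s a x) R \<gamma>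
      = bellman_sol S A (\<lambda>s a x. if (s, a) = (s0, a0) then 0 else K' s a x) R \<gamma>" for R
    using assms by (intro ext bellman_sol_cong) auto
  then show ?thesis by (simp only: loo_value_def)
qed

lemma loo_subkernel:
  "is_subkernel S A K \<Longrightarrow> is_subkernel S A (\<lambda>s a x. if (s, a) = (s0, a0) then 0 else K s a x)"
  unfolding is_subkernel_def
proof (intro allI impI)
  fix s a
  assume "\<forall>s<S. \<forall>a<A. (\<forall>s'<S. 0 \<le> K s a s') \<and> (\<Sum>s'<S. K s a s') \<le> 1" "s < S" "a < A"
  then show "(\<forall>s'<S. 0 \<le> (if (s, a) = (s0, a0) then 0 else K s a s'))
      \<and> (\<Sum>s'<S. if (s, a) = (s0, a0) then 0 else K s a s') \<le> 1"
    by (cases "(s, a) = (s0, a0)") auto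
qed

lemma loo_value_sol:
  assumes K: "is_subkernel S A K" and r: "is_reward S A r" and "0 < A" and \<gamma>: "0 \<le> \<gamma>" "\<gamma> < 1" and u: "0 \<le> u"
  shows "bellman_sol S A (\<lambda>s a x. if (s, a) = (s0, a0) then 0 else K s a x)
    (\<lambda>s a. if (s, a) = (s0, a0) then u else r s a) \<gamma> (loo_value S A K r \<gamma> s0 a0 u)"
proof -
  have "\<exists>V. bellman_sol S A (\<lambda>s a x. if (s, a) = (s0, a0) then 0 else K s a x)
    (\<lambda>s a. if (s, a) = (s0, a0) then u else r s a) \<gamma> V"
    by (rule bellman_sol_exists[OF loo_subkernel[OF K] \<gamma> \<open>0 < A\<close>, where B = "max 1 u"])
       (use r u in \<open>auto simp: is_reward_def max.coboundedI1\<close>)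
  then show ?thesis unfolding loo_value_def by (rule someI_ex)
qed

text \<open>V solves the leave-one-out equation with the final reward z, since the deleted row is
  then replaced by its own contribution. If u changes by d, adding the absolute value of d to one
  solution gives a supersolution for the other, so the solution moves by no more than that.\<close>

lemma loo_value_close:
  assumes K: "is_subkernel S A K" and r: "is_reward S A r" and "0 < A" and \<gamma>: "0 \<le> \<gamma>" "\<gamma> < 1" and u: "0 \<le> u"
    and V: "bellman_sol S A K r \<gamma> V" and s0: "s0 < S" and a0: "a0 < A" and s: "s < S"
  shows "\<bar>loo_value S A K r \<gamma> s0 a0 u s - V s\<bar> \<le> \<bar>u - (r s0 a0 + \<gamma> * mat_vec S (\<lambda>x. K x a0) V s0)\<bar>"
proof -
  define z where "z = r s0 a0 + \<gamma> * mat_vec S (\<lambda>x. K x a0) V s0"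
  let ?K = "\<lambda>s a x. if (s, a) = (s0, a0) then 0 else K s a x"
  let ?R = "\<lambda>u s a. if (s, a) = (s0, a0) then u else r s a"
  let ?W = "loo_value S A K r \<gamma> s0 a0 u"
  note sub = loo_subkernel[OF K, of s0 a0]
  have row: "mat_vec S (\<lambda>x. ?K x a) v s = (if (s, a) = (s0, a0) then 0 else mat_vec S (\<lambda>x. K x a) v s)" for v s a
    by (cases "(s, a) = (s0, a0)") (auto simp: mat_vec_def)
  have W: "bellman_sol S A ?K (?R u) \<gamma> ?W" by (rule loo_value_sol[OF K r \<open>0 < A\<close> \<gamma> u])
  have V': "bellman_sol S A ?K (?R z) \<gamma> V"
  proof -
    have "?R z s a + \<gamma> * mat_vec S (\<lambda>x. ?K x a) V s = r s a + \<gamma> * mat_vec S (\<lambda>x. K x a) V s" for s a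
      unfolding row by (auto simp: z_def)
    then show ?thesis using V unfolding bellman_sol_def by presburger
  qed
  have shift: "f s \<le> g s + \<bar>v - w\<bar>"
    if f: "bellman_sol S A ?K (?R v) \<gamma> f" and g: "bellman_sol S A ?K (?R w) \<gamma> g" for f g v w
  proof (rule bellman_sol_le[OF sub \<gamma> f _ s])
    fix s a assume s: "s < S" and a: "a < A"
    have g': "?R w s a + \<gamma> * mat_vec S (\<lambda>x. ?K x a) g s \<le> g s" using g s a by (simp only: bellman_sol_def)
    have "mat_vec S (\<lambda>x. K x a) (\<lambda>s. g s + \<bar>v - w\<bar>) s = mat_vec S (\<lambda>x. K x a) g s + (\<Sum>x<S. K s a x) * \<bar>v - w\<bar>"
      by (simp only: mat_vec_def distrib_left sum.distrib sum_distrib_right)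
    also have "\<dots> \<le> mat_vec S (\<lambda>x. K x a) g s + 1 * \<bar>v - w\<bar>"
      using K s a by (intro add_left_mono mult_right_mono) (auto simp: is_subkernel_def)
    finally have "\<gamma> * mat_vec S (\<lambda>x. K x a) (\<lambda>s. g s + \<bar>v - w\<bar>) s
        \<le> \<gamma> * (mat_vec S (\<lambda>x. K x a) g s + 1 * \<bar>v - w\<bar>)"
      using \<gamma> by (intro mult_left_mono) auto
    moreover have "\<gamma> * \<bar>v - w\<bar> \<le> 1 * \<bar>v - w\<bar>" using \<gamma> by (intro mult_right_mono) auto
    ultimately show "?R v s a + \<gamma> * mat_vec S (\<lambda>x. ?K x a) (\<lambda>s. g s + \<bar>v - w\<bar>) s \<le> g s + \<bar>v - w\<bar>"
      using g' unfolding row by (auto simp: distrib_left split: if_splits)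
  qed
  show ?thesis using shift[OF W V'] shift[OF V' W] by (simp add: z_def[symmetric] abs_le_iff abs_minus_commute)
qed


section \<open>The gain of near-optimal policies of the empirical model\<close>

lemma span_sp_ge: "x < S \<Longrightarrow> y < S \<Longrightarrow> v x - v y \<le> span_sp S v"
  unfolding span_sp_def by (intro diff_mono) auto

lemma span_sp_le:
  assumes "0 < S" "\<And>x y. x < S \<Longrightarrow> y < S \<Longrightarrow> v x - v y \<le> c"
  shows "span_sp S v \<le> c"
proof -
  have "Max (v ` {..<S}) \<in> v ` {..<S}" "Min (v ` {..<S}) \<in> v ` {..<S}"
    using assms(1) by (auto intro!: Max_in Min_in)
  then obtain x y where "x < S" "y < S" "Max (v ` {..<S}) = v x" "Min (v ` {..<S}) = v y" by auto
  then show ?thesis using assms(2) unfolding span_sp_def by metis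
qed

text \<open>The test functions are (m + \<eta>) / \<beta> - lo + h and (m - \<eta>) / \<beta> - hi +
  h. Discounting a constant c loses \<beta> c, so the first term pays for m and for the error \<eta>
  in each step; the shifts by lo and hi give the leftover of order \<beta> the right sign. The upper
  bound withstands every action by the optimality inequality; the lower bound follows the Blackwell
  policy, whose Poisson equation is exact.\<close>

lemma perturbed_value_bounds:
  assumes P: "is_kernel S A P" and r: "is_reward S A r" and "0 < A" and bw: "blackwell_optimal S A P r \<pi>"
    and const: "\<And>s. s < S \<Longrightarrow> gain S A P r \<pi> s = m"
    and \<beta>: "0 < \<beta>" "\<beta> < 1" and V: "bellman_sol S A K r (1 - \<beta>) V"
    and dev: "\<And>s a. s < S \<Longrightarrow> a < A \<Longrightarrow> \<bar>mat_vec S (\<lambda>x. K x a) V s - mat_vec S (\<lambda>x. P x a) V s\<bar> \<le> \<eta>"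
    and s: "s < S"
  shows "V s \<le> (m + \<eta>) / \<beta> + span_sp S (bias S A P r \<pi>)"
    and "(m - \<eta>) / \<beta> - span_sp S (bias S A P r \<pi>) \<le> V s"
proof -
  let ?h = "bias S A P r \<pi>" and ?H = "span_sp S (bias S A P r \<pi>)"
  have \<pi>: "is_policy S A \<pi>" using bw by (simp add: blackwell_optimal_def)
  define lo where "lo = Min (?h ` {..<S})"
  define hi where "hi = Max (?h ` {..<S})"
  have H: "?H = hi - lo" by (simp add: span_sp_def lo_def hi_def)
  have lohi: "lo \<le> ?h x" "?h x \<le> hi" if "x < S" for x using that by (simp_all add: lo_def hi_def)
  have dev': "(1 - \<beta>) * mat_vec S (\<lambda>x. K x a) V s \<le> (1 - \<beta>) * mat_vec S (\<lambda>x. P x a) V s + \<eta>"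
    "(1 - \<beta>) * mat_vec S (\<lambda>x. P x a) V s - \<eta> \<le> (1 - \<beta>) * mat_vec S (\<lambda>x. K x a) V s"
    if sa: "s < S" "a < A" for s a
  proof -
    define d where "d = mat_vec S (\<lambda>x. K x a) V s - mat_vec S (\<lambda>x. P x a) V s"
    have "\<bar>d\<bar> \<le> \<eta>" using dev[OF sa] by (simp add: d_def)
    moreover have "\<bar>(1 - \<beta>) * d\<bar> \<le> 1 * \<bar>d\<bar>" unfolding abs_mult using \<beta> by (intro mult_right_mono) auto
    ultimately have "\<bar>(1 - \<beta>) * d\<bar> \<le> \<eta>" by simp
    then show "(1 - \<beta>) * mat_vec S (\<lambda>x. K x a) V s \<le> (1 - \<beta>) * mat_vec S (\<lambda>x. P x a) V s + \<eta>"
      "(1 - \<beta>) * mat_vec S (\<lambda>x. P x a) V s - \<eta> \<le> (1 - \<beta>) * mat_vec S (\<lambda>x. K x a) V s"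
      by (simp_all add: d_def right_diff_distrib abs_le_iff)
  qed
  have aff: "mat_vec S M (\<lambda>x. c + ?h x) s = c + mat_vec S M ?h s" if "is_stoch S M" "s < S" for M c s
    using mat_vec_const[OF that] by (simp add: mat_vec_add)
  have "V s - ((m + \<eta>) / \<beta> - lo + ?h s) \<le> 0"
  proof (rule discounted_max_principle[of "1 - \<beta>" S "\<lambda>s. V s - ((m + \<eta>) / \<beta> - lo + ?h s)", OF _ _ _ s])
    fix s assume s: "s < S"
    then obtain a where a: "a < A" "V s = r s a + (1 - \<beta>) * mat_vec S (\<lambda>x. K x a) V s"
      using V by (auto simp: bellman_sol_def)
    let ?P = "mat_vec S (\<lambda>x. P x a)"
    note st = is_stoch_action[OF P a(1)]
    have "lo \<le> ?P ?h s" using mat_vec_stoch_mono[OF st s, of "\<lambda>_. lo" ?h] lohi mat_vec_const[OF st s] by simp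
    then have "0 \<le> \<beta> * (?P ?h s - lo)" using \<beta> by simp
    moreover have "r s a + ?P ?h s \<le> m + ?h s"
      by (rule blackwell_optimality_ineq[OF P r \<open>0 < A\<close> bw const s a(1)])
    moreover have "(1 - \<beta>) * ((m + \<eta>) / \<beta>) = (m + \<eta>) / \<beta> - (m + \<eta>)" using \<beta> by (simp add: field_simps)
    ultimately have "V s - ((m + \<eta>) / \<beta> - lo + ?h s)
        \<le> (1 - \<beta>) * (?P V s - ((m + \<eta>) / \<beta> - lo + ?P ?h s))"
      using dev'(1)[OF s a(1)] a(2) by (simp add: algebra_simps)
    also have "\<dots> = (1 - \<beta>) * (\<Sum>x<S. P s a x * (V x - ((m + \<eta>) / \<beta> - lo + ?h x)))"
      unfolding aff[OF st s, symmetric] mat_vec_diff[symmetric] by (simp add: mat_vec_def)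
    finally show "\<exists>p. (\<forall>x<S. 0 \<le> p x) \<and> sum p {..<S} \<le> 1 \<and> V s - ((m + \<eta>) / \<beta> - lo + ?h s)
        \<le> (1 - \<beta>) * (\<Sum>x<S. p x * (V x - ((m + \<eta>) / \<beta> - lo + ?h x)))"
      using st s unfolding is_stoch_def by (intro exI[of _ "P s a"]) auto
  qed (use \<beta> in auto)
  then show "V s \<le> (m + \<eta>) / \<beta> + ?H" using lohi[OF s] unfolding H by simp
  note st = is_stoch_P_pol[OF P \<pi>]
  let ?P = "mat_vec S (P_pol A P \<pi>)"
  have "((m - \<eta>) / \<beta> - hi + ?h s) - V s \<le> 0 / (1 - (1 - \<beta>))"
  proof (rule stoch_discounted_le[OF st _ _ _ s, where w = "\<lambda>s. ((m - \<eta>) / \<beta> - hi + ?h s) - V s"])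
    fix s assume s: "s < S"
    have "(\<Sum>a<A. \<pi> s a * (r s a + (1 - \<beta>) * mat_vec S (\<lambda>x. P x a) V s - \<eta>)) \<le> V s"
    proof (rule sum_policy_le[OF \<pi> s])
      fix a assume a: "a < A"
      have "r s a + (1 - \<beta>) * mat_vec S (\<lambda>x. K x a) V s \<le> V s" using V s a by (simp add: bellman_sol_def)
      then show "r s a + (1 - \<beta>) * mat_vec S (\<lambda>x. P x a) V s - \<eta> \<le> V s" using dev'(2)[OF s a] by simp
    qed
    moreover have "(\<Sum>a<A. \<pi> s a * (r s a + (1 - \<beta>) * mat_vec S (\<lambda>x. P x a) V s - \<eta>))
        = r_pol A r \<pi> s + (1 - \<beta>) * ?P V s - \<eta>"
    proof -
      have "(\<Sum>a<A. \<pi> s a * \<eta>) = \<eta>" using \<pi> s by (simp add: sum_distrib_right[symmetric] is_policy_def)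
      moreover have "(\<Sum>a<A. \<pi> s a * ((1 - \<beta>) * mat_vec S (\<lambda>x. P x a) V s)) = (1 - \<beta>) * ?P V s"
        unfolding mat_vec_P_pol sum_distrib_left by (intro sum.cong refl) (simp only: mult.left_commute)
      ultimately show ?thesis
        by (simp only: distrib_left right_diff_distrib sum.distrib sum_subtractf r_pol_def)
    qed
    moreover have "r_pol A r \<pi> s = m + ?h s - ?P ?h s"
      using gain_bias(2)[OF P \<pi> s, of r] const[OF s] by simp
    moreover have "?P ?h s \<le> hi" using mat_vec_stoch_mono[OF st s, of ?h "\<lambda>_. hi"] lohi mat_vec_const[OF st s] by simp
    then have "0 \<le> \<beta> * (hi - ?P ?h s)" using \<beta> by simp
    moreover have "(1 - \<beta>) * ((m - \<eta>) / \<beta>) = (m - \<eta>) / \<beta> - (m - \<eta>)" using \<beta> by (simp add: field_simps)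
    ultimately have "((m - \<eta>) / \<beta> - hi + ?h s) - V s \<le> (1 - \<beta>) * (((m - \<eta>) / \<beta> - hi + ?P ?h s) - ?P V s)"
      by (simp add: algebra_simps)
    then show "((m - \<eta>) / \<beta> - hi + ?h s) - V s
        \<le> (1 - \<beta>) * ?P (\<lambda>s. ((m - \<eta>) / \<beta> - hi + ?h s) - V s) s + 0"
      unfolding mat_vec_diff aff[OF st s] by simp
  qed (use \<beta> in auto)
  then show "(m - \<eta>) / \<beta> - ?H \<le> V s" using lohi[OF s] unfolding H by simp
qed

text \<open>Pointwise, r_pi - (v - P_pi v) is at least (1 - \<gamma>) c - \<eta>. Since Q P_pi = Q,
  averaging by Q annihilates v - P_pi v, however large v is.\<close>

lemma gain_lower_bound:
  assumes P: "is_kernel S A P" and \<pi>: "is_policy S A \<pi>" and \<gamma>: "0 \<le> \<gamma>" "\<gamma> \<le> 1"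
    and v: "\<And>s. s < S \<Longrightarrow> v s = r_pol A r \<pi> s + \<gamma> * mat_vec S K v s"
    and dev: "\<And>s. s < S \<Longrightarrow> \<bar>mat_vec S K v s - mat_vec S (P_pol A P \<pi>) v s\<bar> \<le> \<eta>"
    and c: "\<And>s. s < S \<Longrightarrow> c \<le> v s" and s: "s < S"
  shows "(1 - \<gamma>) * c - \<eta> \<le> gain S A P r \<pi> s"
proof -
  let ?P = "mat_vec S (P_pol A P \<pi>)" and ?Q = "mat_vec S (lim_mat S (P_pol A P \<pi>))"
  note st = is_stoch_P_pol[OF P \<pi>]
  note Q = lim_mat_stoch[OF st]
  have "(v s - ?P v s) + ((1 - \<gamma>) * c - \<eta>) \<le> r_pol A r \<pi> s" if s: "s < S" for s
  proof -
    have "c \<le> ?P v s" using mat_vec_stoch_mono[OF st s, of "\<lambda>_. c" v] c mat_vec_const[OF st s] by simp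
    then have "(1 - \<gamma>) * c \<le> (1 - \<gamma>) * ?P v s" using \<gamma> by (intro mult_left_mono) auto
    moreover have "\<gamma> * \<bar>mat_vec S K v s - ?P v s\<bar> \<le> 1 * \<bar>mat_vec S K v s - ?P v s\<bar>"
      using \<gamma> by (intro mult_right_mono) auto
    then have "\<bar>\<gamma> * (mat_vec S K v s - ?P v s)\<bar> \<le> \<eta>" using dev[OF s] \<gamma> by (simp add: abs_mult)
    ultimately show ?thesis using v[OF s] by (simp add: algebra_simps abs_le_iff)
  qed
  then have "?Q (\<lambda>s. (v s - ?P v s) + ((1 - \<gamma>) * c - \<eta>)) s \<le> ?Q (r_pol A r \<pi>) s"
    by (rule mat_vec_stoch_mono[OF Q s])
  then show ?thesis
    unfolding gain_def mat_vec_add mat_vec_diff lim_mat_invariant(1)[OF st s] mat_vec_const[OF Q s] by simp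
qed

text \<open>The deterministic core: what remains are inequalities between H = span h, W = span V and
  \<beta>. The tolerance 1/N is at most \<beta> / 128, so it is absorbed together with the grid
  error.\<close>

lemma gain_gap_bound:
  assumes P: "is_kernel S A P" and r: "is_reward S A r" and "0 < S" "0 < A"
    and wc: "weakly_communicating S A P" and bw: "blackwell_optimal S A P r \<pi>star"
    and K: "is_kernel S A K" and \<pi>: "is_policy S A \<pi>"
    and \<beta>: "0 < \<beta>" "\<beta> < 1" and N: "1 \<le> N" "128 / N \<le> \<beta>\<^sup>2"
    and V: "bellman_sol S A K r (1 - \<beta>) V"
    and near: "\<And>s. s < S \<Longrightarrow> V s - 1 / N \<le> disc_value S A K r (1 - \<beta>) \<pi> s"
    and dev: "\<And>s a. s < S \<Longrightarrow> a < A \<Longrightarrow>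
      \<bar>mat_vec S (\<lambda>x. K x a) V s - mat_vec S (\<lambda>x. P x a) V s\<bar> \<le> \<beta> / 8 * (span_sp S V + 2 / N) + 2 / N"
    and s: "s < S"
  shows "gain S A P r \<pi>star s - gain S A P r \<pi> s \<le> 3 * \<beta> * (span_sp S (bias S A P r \<pi>star) + 1)"
proof -
  obtain m where m: "\<And>s. s < S \<Longrightarrow> gain S A P r \<pi>star s = m"
    using blackwell_gain_const[OF P r \<open>0 < A\<close> bw wc] by blast
  define H where "H = span_sp S (bias S A P r \<pi>star)"
  define W where "W = span_sp S V"
  define \<eta> where "\<eta> = \<beta> / 8 * (W + 2 / N) + 2 / N"
  have H: "0 \<le> H" using span_sp_ge[OF s s, of "bias S A P r \<pi>star"] by (simp add: H_def)
  have \<gamma>: "0 \<le> 1 - \<beta>" "1 - \<beta> < 1" using \<beta> by auto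
  have N1: "1 / N \<le> \<beta> / 128"
  proof -
    have "\<beta>\<^sup>2 \<le> \<beta> * 1" unfolding power2_eq_square using \<beta> by (intro mult_left_mono) auto
    then show ?thesis using N by simp
  qed
  have bN: "\<beta> * (1 / N) \<le> \<beta> / 128" using mult_left_mono[of "1 / N" "1 / 128" \<beta>] \<beta> N1 by simp
  \<comment> \<open>The terms free of W add up to at most \<beta> / 512 + \<beta> / 64, which is
    below \<beta> / 50.\<close>
  have \<eta>W: "\<eta> \<le> \<beta> * (W / 8 + 1 / 50)"
  proof -
    define t where "t = 1 / N"
    have "\<eta> = \<beta> * W / 8 + \<beta> * t / 4 + 2 * t" by (simp add: \<eta>_def t_def algebra_simps)
    moreover have "\<beta> * (W / 8 + 1 / 50) = \<beta> * W / 8 + \<beta> / 50" by (simp add: distrib_left)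
    ultimately show ?thesis using N1[folded t_def] bN[folded t_def] \<beta>(1) by linarith
  qed
  note perturbed = perturbed_value_bounds[OF P r \<open>0 < A\<close> bw m \<beta> V dev, folded W_def H_def, folded \<eta>_def]
  have bounds: "V x \<le> (m + \<eta>) / \<beta> + H" "(m - \<eta>) / \<beta> - H \<le> V x" if "x < S" for x
    using perturbed that by blast+
  \<comment> \<open>\<eta> itself contains W. As \<eta> / \<beta> <= W / 8 + 1 / 50, the right side
    contains only W / 4, and W can be solved for.\<close>
  have "W \<le> 2 * H + 2 * (\<eta> / \<beta>)"
    unfolding W_def
  proof (rule span_sp_le[OF \<open>0 < S\<close>])
    fix x y assume "x < S" "y < S"
    then show "V x - V y \<le> 2 * H + 2 * (\<eta> / \<beta>)"
      using bounds(1)[of x] bounds(2)[of y] by (simp add: add_divide_distrib diff_divide_distrib)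
  qed
  moreover have \<eta>b: "\<eta> / \<beta> \<le> W / 8 + 1 / 50" using \<eta>W \<beta> by (simp add: field_simps)
  ultimately have WH: "W \<le> 3 * H + 1" using H by simp
  then have \<eta>H': "\<eta> / \<beta> \<le> H + 1 / 2" using \<eta>b H by simp
  then have \<eta>H: "\<eta> \<le> \<beta> * (H + 1 / 2)" using \<beta> by (simp add: field_simps)
  let ?v = "disc_value S A K r (1 - \<beta>) \<pi>"
  have lower: "m / \<beta> - 2 * H - 1 / 2 - 1 / N \<le> ?v x" if "x < S" for x
    using near[OF that] bounds(2)[OF that] \<eta>H' by (simp add: diff_divide_distrib)
  have vV: "?v x \<le> V x" if "x < S" for x
    by (rule disc_value_le_bellman[OF K r \<pi> \<gamma> V that])
  have dev\<pi>: "\<bar>mat_vec S (P_pol A K \<pi>) ?v x - mat_vec S (P_pol A P \<pi>) ?v x\<bar> \<le> \<eta> + 1 / N" if x: "x < S" for x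
  proof -
    let ?k = "mat_vec S (P_pol A K \<pi>)" and ?p = "mat_vec S (P_pol A P \<pi>)"
    have diff: "?k V x - ?p V x = (\<Sum>a<A. \<pi> x a * (mat_vec S (\<lambda>x. K x a) V x - mat_vec S (\<lambda>x. P x a) V x))"
      by (simp add: mat_vec_P_pol right_diff_distrib sum_subtractf)
    have "?k V x - ?p V x \<le> \<eta>"
      unfolding diff using dev[OF x] by (intro sum_policy_le[OF \<pi> x]) (simp add: \<eta>_def W_def abs_le_iff)
    moreover have "?p V x - ?k V x \<le> \<eta>"
    proof -
      have "?p V x - ?k V x = (\<Sum>a<A. \<pi> x a * (mat_vec S (\<lambda>x. P x a) V x - mat_vec S (\<lambda>x. K x a) V x))"
        by (simp add: mat_vec_P_pol right_diff_distrib sum_subtractf)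
      also have "\<dots> \<le> \<eta>"
        using dev[OF x] by (intro sum_policy_le[OF \<pi> x]) (simp add: \<eta>_def W_def abs_le_iff)
      finally show ?thesis .
    qed
    \<comment> \<open>Passing from V to the value of \<pi> changes both products by an amount in
      [0, 1/N], so their difference moves by at most 1/N. Through this step one bound for V serves
      every near-optimal policy.\<close>
    moreover have "0 \<le> mat_vec S (P_pol A L \<pi>) V x - mat_vec S (P_pol A L \<pi>) ?v x
        \<and> mat_vec S (P_pol A L \<pi>) V x - mat_vec S (P_pol A L \<pi>) ?v x \<le> 1 / N"
      if "is_kernel S A L" for L
    proof -
      note st = is_stoch_P_pol[OF that \<pi>]
      have "mat_vec S (P_pol A L \<pi>) (\<lambda>_. 0) x \<le> mat_vec S (P_pol A L \<pi>) (\<lambda>x. V x - ?v x) x"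
        using vV by (intro mat_vec_stoch_mono[OF st x]) simp
      moreover have "mat_vec S (P_pol A L \<pi>) (\<lambda>x. V x - ?v x) x \<le> mat_vec S (P_pol A L \<pi>) (\<lambda>_. 1 / N) x"
        using near by (intro mat_vec_stoch_mono[OF st x]) (simp add: algebra_simps)
      ultimately show ?thesis using mat_vec_const[OF st x] by (simp add: mat_vec_diff)
    qed
    note this[OF K] this[OF P]
    ultimately show ?thesis by (simp add: abs_le_iff)
  qed
  have "(1 - (1 - \<beta>)) * (m / \<beta> - 2 * H - 1 / 2 - 1 / N) - (\<eta> + 1 / N) \<le> gain S A P r \<pi> s"
    by (rule gain_lower_bound[OF P \<pi> \<gamma>(1) _ disc_value_eq[OF K r \<pi> \<gamma>] dev\<pi> lower s]) (use \<gamma> in auto)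
  then have "m - \<beta> * (2 * H + 1 / 2) - \<beta> * (1 / N) - \<eta> - 1 / N \<le> gain S A P r \<pi> s"
    using \<beta> by (simp add: algebra_simps)
  moreover define y where "y = \<beta> * H"
  moreover define t where "t = 1 / N"
  ultimately have "m - (2 * y + \<beta> / 2) - \<beta> * t - \<eta> - t \<le> gain S A P r \<pi> s"
    by (simp add: algebra_simps)
  moreover have "\<eta> \<le> y + \<beta> / 2" using \<eta>H by (simp add: y_def algebra_simps)
  moreover have "\<beta> * t \<le> \<beta> / 128" "t \<le> \<beta> / 128" using bN N1 by (simp_all only: t_def)
  ultimately have "m - gain S A P r \<pi> s \<le> 3 * y + 3 * \<beta>" using \<beta>(1) by linarith
  then have "m - gain S A P r \<pi> s \<le> 3 * \<beta> * (H + 1)" by (simp add: y_def algebra_simps)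
  then show ?thesis using m[OF s] by (simp add: H_def)
qed

lemma bellman_sol_bounds:
  assumes K: "is_kernel S A K" and r: "is_reward S A r" and "0 < A" and \<gamma>: "0 \<le> \<gamma>" "\<gamma> < 1"
    and V: "bellman_sol S A K r \<gamma> V" and s: "s < S"
  shows "0 \<le> V s" "V s \<le> 1 / (1 - \<gamma>)"
proof -
  have "V s \<le> (\<lambda>_. 1 / (1 - \<gamma>)) s"
  proof (rule bellman_sol_le[OF is_kernel_subkernel[OF K] \<gamma> V _ s])
    fix s a assume s: "s < S" and a: "a < A"
    have "r s a + \<gamma> * (1 / (1 - \<gamma>)) \<le> 1 + \<gamma> * (1 / (1 - \<gamma>))" using r s a by (simp add: is_reward_def)
    also have "\<dots> = 1 / (1 - \<gamma>)" using \<gamma> by (simp add: field_simps)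
    finally show "r s a + \<gamma> * mat_vec S (\<lambda>x. K x a) (\<lambda>_. 1 / (1 - \<gamma>)) s \<le> 1 / (1 - \<gamma>)"
      using mat_vec_const[OF is_stoch_action[OF K a] s] by simp
  qed
  then show "V s \<le> 1 / (1 - \<gamma>)" .
  have "- V s \<le> 0 / (1 - \<gamma>)"
  proof (rule stoch_discounted_le[OF is_stoch_action[OF K \<open>0 < A\<close>] \<gamma> _ s, where w = "\<lambda>s. - V s"])
    fix s assume s: "s < S"
    have "r s 0 + \<gamma> * mat_vec S (\<lambda>x. K x 0) V s \<le> V s" "0 \<le> r s 0"
      using V r s \<open>0 < A\<close> by (auto simp: bellman_sol_def is_reward_def)
    moreover have "mat_vec S (\<lambda>x. K x 0) (\<lambda>s. - V s) s = - mat_vec S (\<lambda>x. K x 0) V s"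
      by (simp add: mat_vec_def sum_negf)
    ultimately show "- V s \<le> \<gamma> * mat_vec S (\<lambda>x. K x 0) (\<lambda>s. - V s) s + 0" by simp
  qed
  then show "0 \<le> V s" by simp
qed

text \<open>k / n is u rounded down to the grid. As 0 <= u <= V s <= 1 / (1 - \<gamma>) <= n, the
  index k is at most n^2. Rounding moves V by at most 1/n in each state, hence the span by at most
  2/n and each of the two products by at most 1/n.\<close>

lemma deviation_from_loo:
  assumes P: "is_kernel S A P" and K: "is_kernel S A K" and r: "is_reward S A r" and "0 < A"
    and \<gamma>: "0 \<le> \<gamma>" "\<gamma> < 1" and n: "0 < n" "1 / (1 - \<gamma>) \<le> real n" and \<epsilon>: "0 \<le> \<epsilon>"
    and V: "bellman_sol S A K r \<gamma> V" and s: "s < S" and a: "a < A"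
    and good: "\<And>k. k \<le> n\<^sup>2 \<Longrightarrow>
      \<bar>mat_vec S (\<lambda>x. K x a) (loo_value S A K r \<gamma> s a (real k / real n)) s
        - mat_vec S (\<lambda>x. P x a) (loo_value S A K r \<gamma> s a (real k / real n)) s\<bar>
      \<le> \<epsilon> * span_sp S (loo_value S A K r \<gamma> s a (real k / real n))"
  shows "\<bar>mat_vec S (\<lambda>x. K x a) V s - mat_vec S (\<lambda>x. P x a) V s\<bar> \<le> \<epsilon> * (span_sp S V + 2 / real n) + 2 / real n"
proof -
  define u where "u = r s a + \<gamma> * mat_vec S (\<lambda>x. K x a) V s"
  define k where "k = nat \<lfloor>u * real n\<rfloor>"
  define V' where "V' = loo_value S A K r \<gamma> s a (real k / real n)"
  note b = bellman_sol_bounds[OF K r \<open>0 < A\<close> \<gamma> V]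
  have "0 \<le> mat_vec S (\<lambda>x. K x a) V s"
    using mat_vec_stoch_mono[OF is_stoch_action[OF K a] s, of "\<lambda>_. 0" V] b(1)
    by (simp add: mat_vec_const[OF is_stoch_action[OF K a] s])
  then have u0: "0 \<le> u" using r s a \<gamma> by (simp add: u_def is_reward_def)
  have "u \<le> V s" using V s a by (simp add: u_def bellman_sol_def)
  also have "\<dots> \<le> real n" using b(2)[OF s] n by simp
  finally have "u * real n \<le> real n * real n" by (intro mult_right_mono) auto
  moreover have k: "real k \<le> u * real n" "u * real n < real k + 1" using u0 by (auto simp: k_def)
  ultimately have "real k \<le> real (n\<^sup>2)" by (simp add: power2_eq_square)
  then have kn: "k \<le> n\<^sup>2" by linarith
  have uk: "\<bar>real k / real n - u\<bar> \<le> 1 / real n"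
  proof -
    have "real k / real n - u = (real k - u * real n) / real n" using n by (simp add: field_simps)
    then show ?thesis using k by (simp add: divide_right_mono)
  qed
  have close: "\<bar>V' x - V x\<bar> \<le> 1 / real n" if "x < S" for x
    using loo_value_close[OF is_kernel_subkernel[OF K] r \<open>0 < A\<close> \<gamma> _ V s a that, of "real k / real n"] uk
    by (simp add: V'_def u_def)
  have "span_sp S V' \<le> span_sp S V + 2 / real n"
  proof (rule span_sp_le)
    show "V' x - V' y \<le> span_sp S V + 2 / real n" if "x < S" "y < S" for x y
      using close[OF that(1)] close[OF that(2)] span_sp_ge[OF that, of V] by (simp add: abs_le_iff)
  qed (use s in auto)
  then have "\<epsilon> * span_sp S V' \<le> \<epsilon> * (span_sp S V + 2 / real n)" using \<epsilon> by (rule mult_left_mono)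
  then have "\<bar>mat_vec S (\<lambda>x. K x a) V' s - mat_vec S (\<lambda>x. P x a) V' s\<bar> \<le> \<epsilon> * (span_sp S V + 2 / real n)"
    using good[OF kn, folded V'_def] by simp
  moreover have "\<bar>mat_vec S (\<lambda>x. L x a) V' s - mat_vec S (\<lambda>x. L x a) V s\<bar> \<le> 1 / real n" if "is_kernel S A L" for L
    using mat_vec_stoch_bound[OF is_stoch_action[OF that a] s close] by (simp add: mat_vec_diff)
  note this[OF K] this[OF P]
  ultimately show ?thesis by (simp add: abs_le_iff)
qed

text \<open>Settles the one triple S = A = n = 1 in which the logarithm may be smaller than 1: with
  a single state and action every policy earns the same gain.\<close>

lemma gain_singleton:
  assumes P: "is_kernel 1 1 P" and \<pi>: "is_policy 1 1 \<pi>"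
  shows "gain 1 1 P r \<pi> 0 = r 0 0"
proof -
  have "P_pol 1 P \<pi> 0 0 = 1" using is_stoch_P_pol[OF P \<pi>] by (simp add: is_stoch_def)
  then have "gain 1 1 P r \<pi> 0 = r_pol 1 r \<pi> 0"
    using gain_bias(2)[OF P \<pi>, of 0 r] by (simp add: mat_vec_def)
  then show ?thesis using \<pi> by (simp add: r_pol_def is_policy_def)
qed


section \<open>Union bound and choice of the constants\<close>

definition loo_deviates where
  "loo_deviates S A P r \<gamma> n \<epsilon> s a k \<omega> \<longleftrightarrow>
    \<epsilon> * span_sp S (loo_value S A (emp_kernel n \<omega>) r \<gamma> s a (real k / real n))
    < \<bar>mat_vec S (\<lambda>x. emp_kernel n \<omega> x a) (loo_value S A (emp_kernel n \<omega>) r \<gamma> s a (real k / real n)) s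
       - mat_vec S (\<lambda>x. P x a) (loo_value S A (emp_kernel n \<omega>) r \<gamma> s a (real k / real n)) s\<bar>"

text \<open>The union runs over pairs and grid indices; the event mentions no policy, so it serves
  all of them.\<close>

lemma loo_deviates_prob:
  assumes "is_kernel S A P" "0 < n" "0 \<le> \<epsilon>"
  shows "measure_pmf.prob (sample_pmf S A P n) {\<omega>. \<exists>s<S. \<exists>a<A. \<exists>k\<le>n\<^sup>2. loo_deviates S A P r \<gamma> n \<epsilon> s a k \<omega>}
    \<le> real S * real A * (real n ^ 2 + 1) * (2 * exp (- 2 * real n * \<epsilon>\<^sup>2))"
proof -
  let ?I = "{..<S} \<times> {..<A} \<times> {..n\<^sup>2}" and ?p = "measure_pmf.prob (sample_pmf S A P n)"
  let ?B = "\<lambda>(s, a, k). {\<omega>. loo_deviates S A P r \<gamma> n \<epsilon> s a k \<omega>}"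
  have "{\<omega>. \<exists>s<S. \<exists>a<A. \<exists>k\<le>n\<^sup>2. loo_deviates S A P r \<gamma> n \<epsilon> s a k \<omega>} = (\<Union>i\<in>?I. ?B i)" by auto
  then have "?p {\<omega>. \<exists>s<S. \<exists>a<A. \<exists>k\<le>n\<^sup>2. loo_deviates S A P r \<gamma> n \<epsilon> s a k \<omega>} \<le> (\<Sum>i\<in>?I. ?p (?B i))"
    by (simp only:) (rule measure_pmf.finite_measure_subadditive_finite, auto)
  also have "\<dots> \<le> (\<Sum>i\<in>?I. 2 * exp (- 2 * real n * \<epsilon>\<^sup>2))"
  proof (rule sum_mono)
    fix i assume "i \<in> ?I"
    then obtain s a k where i: "i = (s, a, k)" "s < S" "a < A" by auto
    have "?p {\<omega>. loo_deviates S A P r \<gamma> n \<epsilon> s a k \<omega>} \<le> 2 * exp (- 2 * real n * \<epsilon>\<^sup>2)"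
      unfolding loo_deviates_def
    proof (rule deviation_prob[OF assms(1) i(2,3) assms(2,3)])
      fix \<omega> \<omega>' :: "nat \<times> nat \<times> nat \<Rightarrow> nat"
      assume eq: "\<And>x b i. x < S \<Longrightarrow> b < A \<Longrightarrow> i < n \<Longrightarrow> (x, b) \<noteq> (s, a) \<Longrightarrow> \<omega> (x, b, i) = \<omega>' (x, b, i)"
      have "emp_kernel n \<omega> x b y = emp_kernel n \<omega>' x b y" if "x < S" "b < A" "(x, b) \<noteq> (s, a)" for x b y
      proof -
        have "{i. i < n \<and> \<omega> (x, b, i) = y} = {i. i < n \<and> \<omega>' (x, b, i) = y}" using eq[OF that(1,2) _ that(3)] by auto
        then show ?thesis by (simp add: emp_kernel_def)
      qed
      then show "loo_value S A (emp_kernel n \<omega>) r \<gamma> s a (real k / real n)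
          = loo_value S A (emp_kernel n \<omega>') r \<gamma> s a (real k / real n)"
        by (intro loo_value_cong)
    qed
    then show "?p (?B i) \<le> 2 * exp (- 2 * real n * \<epsilon>\<^sup>2)" by (simp add: i)
  qed
  also have "\<dots> = real S * real A * (real n ^ 2 + 1) * (2 * exp (- 2 * real n * \<epsilon>\<^sup>2))" by (simp add: card_cartesian_product algebra_simps)
  finally show ?thesis .
qed

lemma good_event_gap:
  assumes P: "is_kernel S A P" and r: "is_reward S A r" and "0 < S" "0 < A" and wc: "weakly_communicating S A P"
    and \<beta>: "0 < \<beta>" "\<beta> < 1" and n: "0 < n" "128 / real n \<le> \<beta>\<^sup>2" and \<epsilon>: "0 \<le> \<epsilon>" "\<epsilon> \<le> \<beta> / 8"
    and \<omega>: "\<omega> \<in> set_pmf (sample_pmf S A P n)"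
    and good: "\<And>s a k. s < S \<Longrightarrow> a < A \<Longrightarrow> k \<le> n\<^sup>2 \<Longrightarrow> \<not> loo_deviates S A P r (1 - \<beta>) n \<epsilon> s a k \<omega>"
    and \<pi>: "is_policy S A \<pi>" and near: "\<And>s. s < S \<Longrightarrow>
      opt_disc_value S A (emp_kernel n \<omega>) r (1 - \<beta>) s - 1 / real n \<le> disc_value S A (emp_kernel n \<omega>) r (1 - \<beta>) \<pi> s"
    and bw: "blackwell_optimal S A P r \<pi>star" and s: "s < S"
  shows "gain S A P r \<pi>star s - gain S A P r \<pi> s \<le> 3 * \<beta> * (span_sp S (bias S A P r \<pi>star) + 1)"
proof -
  let ?K = "emp_kernel n \<omega>"
  have \<gamma>: "0 \<le> 1 - \<beta>" "1 - \<beta> < 1" using \<beta> by auto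
  \<comment> \<open>Outside the support a sample may leave the state space, and the empirical rows
    then lose mass.\<close>
  have K: "is_kernel S A ?K" 
    by (rule emp_kernel_is_kernel) (use sample_support[OF P \<omega>] n in auto)
  obtain V where V: "bellman_sol S A ?K r (1 - \<beta>) V"
    using bellman_sol_exists[OF is_kernel_subkernel[OF K] \<gamma> \<open>0 < A\<close>, of r 1] r by (auto simp: is_reward_def)
  have "1 \<le> \<beta>\<^sup>2 * real n" using n by (simp add: field_simps)
  also have "\<beta>\<^sup>2 * real n \<le> \<beta> * real n"
    unfolding power2_eq_square using \<beta> by (intro mult_right_mono) auto
  finally have \<beta>n: "1 / (1 - (1 - \<beta>)) \<le> real n" using \<beta> by (simp add: field_simps)
  show ?thesis
  proof (rule gain_gap_bound[OF P r \<open>0 < S\<close> \<open>0 < A\<close> wc bw K \<pi> \<beta> _ n(2) V _ _ s])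
    show "1 \<le> real n" using n by simp
    show "V s - 1 / real n \<le> disc_value S A ?K r (1 - \<beta>) \<pi> s" if "s < S" for s
      using near[OF that] opt_disc_value_bellman[OF K r \<gamma> V that] by simp
    fix s a assume sa: "s < S" "a < A"
    have "\<bar>mat_vec S (\<lambda>x. ?K x a) V s - mat_vec S (\<lambda>x. P x a) V s\<bar> \<le> \<epsilon> * (span_sp S V + 2 / real n) + 2 / real n"
      by (rule deviation_from_loo[OF P K r \<open>0 < A\<close> \<gamma> n(1) \<beta>n \<epsilon>(1) V sa])
         (use good[OF sa] in \<open>simp add: loo_deviates_def not_less\<close>)
    also have "\<epsilon> * (span_sp S V + 2 / real n) \<le> \<beta> / 8 * (span_sp S V + 2 / real n)"
      using \<epsilon>(2) span_sp_ge[OF s s, of V] by (intro mult_right_mono) auto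
    finally show "\<bar>mat_vec S (\<lambda>x. ?K x a) V s - mat_vec S (\<lambda>x. P x a) V s\<bar>
        \<le> \<beta> / 8 * (span_sp S V + 2 / real n) + 2 / real n" by simp
  qed
qed

text \<open>Used with c = S A, n2 = n^2 and X = S A n^2 / \<delta>. Doubling n^2 absorbs the extra
  grid point, and the total becomes 4 \<delta> / X^3.\<close>

lemma failure_prob_bound:
  fixes \<delta> X :: real
  assumes "0 < \<delta>" "0 < X" "c * n2 = X * \<delta>" "1 \<le> n2" "0 \<le> c" "4 \<le> X ^ 3"
  shows "c * (n2 + 1) * (2 * (1 / X ^ 4)) \<le> \<delta>"
proof -
  have "c * (n2 + 1) \<le> c * (2 * n2)" using assms by (intro mult_left_mono) auto
  also have "\<dots> = 2 * X * \<delta>" using assms by simp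
  finally have "c * (n2 + 1) * (2 * (1 / X ^ 4)) \<le> 2 * X * \<delta> * (2 * (1 / X ^ 4))"
    using assms by (intro mult_right_mono) auto
  also have "\<dots> = 4 * \<delta> / X ^ 3" using assms by (simp add: field_simps eval_nat_numeral)
  also have "\<dots> \<le> \<delta>" using assms by (simp add: field_simps)
  finally show ?thesis .
qed

text \<open>For n >= 2 one has X > 4 > e. For n = 1 and S A >= 2 one has X > 2, so ln X >= 2/3; as
  128 (2/3)^3 > 1, this contradicts the upper bound on the square root.\<close>

lemma log_factor_ge_1:
  assumes "0 < S" "0 < A" "0 < \<delta>" "\<delta> < 1" and not1: "\<not> (S = 1 \<and> A = 1 \<and> n = 1)"
    and \<gamma>: "0 < sqrt (128 * (ln (real S * real A * real n ^ 2 / \<delta>)) ^ 3 / real n)"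
    "sqrt (128 * (ln (real S * real A * real n ^ 2 / \<delta>)) ^ 3 / real n) < 1"
  shows "1 \<le> ln (real S * real A * real n ^ 2 / \<delta>)"
proof -
  define X where "X = real S * real A * real n ^ 2 / \<delta>"
  \<comment> \<open>Division by 0 yields 0, so n = 0 would make the square root 0.\<close>
  have "n \<noteq> 0" using \<gamma>(1) by (cases n) auto
  then have n: "1 \<le> n" by simp
  have "0 < 128 * ln X ^ 3 / real n" "128 * ln X ^ 3 / real n < 1" using \<gamma> by (auto simp: X_def)
  then have L3: "128 * ln X ^ 3 < real n" using n by (simp add: field_simps)
  have X: "real (S * A * n\<^sup>2) < X"
  proof -
    have "real (S * A * n\<^sup>2) * \<delta> < real (S * A * n\<^sup>2) * 1"
      using assms n by (intro mult_strict_left_mono) auto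
    then show ?thesis using assms by (simp add: X_def field_simps)
  qed
  have "1 \<le> ln X"
  proof (cases "n = 1")
    case True
    with not1 have "S * A \<noteq> 1" by auto
    moreover have "S * A \<noteq> 0" using assms by auto
    ultimately have "2 \<le> S * A" by linarith
    then have "2 \<le> X" using X True by (metis mult.right_neutral nat_le_real_less of_nat_numeral one_power2 order_le_less_trans order_less_imp_le of_nat_le_iff)
    then have "ln 2 \<le> ln X" by simp
    then have "2 / 3 \<le> ln X" using ln2_ge_two_thirds by linarith
    then have "(2 / 3) ^ 3 \<le> ln X ^ 3" by (intro power_mono) auto
    then show ?thesis using L3 True by (simp add: eval_nat_numeral)
  next
    case False
    then have "2 \<le> n" using n by simp
    then have "2\<^sup>2 \<le> n\<^sup>2" by (rule power_mono) simp
    also have "1 * n\<^sup>2 \<le> S * A * n\<^sup>2" using assms by (intro mult_right_mono) (auto simp: Suc_le_eq)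
    finally have "real (2\<^sup>2) \<le> real (S * A * n\<^sup>2)" by (intro of_nat_mono) simp
    then have "3 \<le> X" using X by simp
    then have "exp 1 \<le> X" using exp_le by linarith
    then have "ln (exp 1) \<le> ln X" using \<open>3 \<le> X\<close> by (subst ln_le_cancel_iff) auto
    then show ?thesis by simp
  qed
  then show ?thesis by (simp add: X_def)
qed

text \<open>S A n^2 / \<delta> is at most the square of S A n / \<delta>, because S A / \<delta> >=
  1. This reconciles the logarithm in the discount factor with the one in the rate.\<close>

lemma log_factor_compare:
  assumes "0 < S" "0 < A" "0 < \<delta>" "\<delta> < 1" "0 < n"
  shows "ln (real S * real A * real n ^ 2 / \<delta>) \<le> 2 * ln (real S * real A * real n / \<delta>)"
proof -
  let ?Y = "real S * real A * real n / \<delta>"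
  have "1 \<le> real S * real A" using assms by (metis Suc_leI mult_pos_pos of_nat_1 of_nat_le_iff of_nat_mult One_nat_def)
  then have SA: "1 \<le> real S * real A / \<delta>" using assms by (simp add: field_simps)
  have "real S * real A * real n ^ 2 / \<delta> * 1 \<le> real S * real A * real n ^ 2 / \<delta> * (real S * real A / \<delta>)"
    using SA assms by (intro mult_left_mono) auto
  also have "\<dots> = ?Y ^ 2" by (simp add: power2_eq_square)
  finally have "ln (real S * real A * real n ^ 2 / \<delta>) \<le> ln (?Y ^ 2)"
    using assms by (subst ln_le_cancel_iff) auto
  also have "\<dots> = 2 * ln ?Y" using assms by (subst ln_realpow) auto
  finally show ?thesis .
qed

text \<open>18432 = 9 * 128 * 8 * 2: the square of 3, the constant in \<beta>, the cube of 2 from L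
  <= 2 l, and the 2 in (H + 1)^2 <= 2 (H^2 + 1).\<close>

lemma gap_rate_bound:
  fixes L l n H :: real
  assumes "0 \<le> L" "L \<le> 2 * l" "0 < n" "0 \<le> H"
  shows "3 * sqrt (128 * L ^ 3 / n) * (H + 1) \<le> sqrt (18432 * l ^ 3 / n * (H\<^sup>2 + 1))"
proof (rule real_le_rsqrt)
  have "L ^ 3 \<le> (2 * l) ^ 3" using assms by (intro power_mono)
  then have "128 * L ^ 3 / n \<le> 1024 * l ^ 3 / n" using assms by (intro divide_right_mono) (auto simp: power_mult_distrib)
  moreover have "(H + 1)\<^sup>2 \<le> 2 * (H\<^sup>2 + 1)"
    using zero_le_power2[of "H - 1"] by (simp add: power2_eq_square algebra_simps)
  ultimately have "(128 * L ^ 3 / n) * (H + 1)\<^sup>2 \<le> (1024 * l ^ 3 / n) * (2 * (H\<^sup>2 + 1))"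
    using assms by (intro mult_mono) auto
  moreover have "(3 * sqrt (128 * L ^ 3 / n) * (H + 1))\<^sup>2 = 9 * ((128 * L ^ 3 / n) * (H + 1)\<^sup>2)"
    using assms by (simp add: power_mult_distrib)
  ultimately have "(3 * sqrt (128 * L ^ 3 / n) * (H + 1))\<^sup>2 \<le> 9 * ((1024 * l ^ 3 / n) * (2 * (H\<^sup>2 + 1)))"
    by linarith
  then show "(3 * sqrt (128 * L ^ 3 / n) * (H + 1))\<^sup>2 \<le> 18432 * l ^ 3 / n * (H\<^sup>2 + 1)" by (simp add: algebra_simps)
qed

lemma gain_gap_prob:
  assumes S: "S > 0" and A: "A > 0" and P: "is_kernel S A P" and r: "is_reward S A r"
    and wc: "weakly_communicating S A P" and \<delta>: "0 < \<delta>" "\<delta> < 1"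
    and not1: "\<not> (S = 1 \<and> A = 1 \<and> n = 1)"
  defines "\<beta> \<equiv> sqrt (128 * (ln (real S * real A * real n ^ 2 / \<delta>)) ^ 3 / real n)"
  assumes \<beta>: "0 < \<beta>" "\<beta> < 1"
  shows "1 - \<delta> \<le> measure_pmf.prob (sample_pmf S A P n)
    {\<omega>. \<forall>\<pi>. is_policy S A \<pi> \<and>
       (\<forall>s<S. disc_value S A (emp_kernel n \<omega>) r (1 - \<beta>) \<pi> s
                \<ge> opt_disc_value S A (emp_kernel n \<omega>) r (1 - \<beta>) s - 1 / real n) \<longrightarrow>
     (\<forall>\<pi>star. blackwell_optimal S A P r \<pi>star \<longrightarrow>
       (\<forall>s<S. gain S A P r \<pi>star s - gain S A P r \<pi> s
         \<le> sqrt (18432 * (ln (real S * real A * real n / \<delta>)) ^ 3 / real n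
                  * ((span_sp S (bias S A P r \<pi>star))\<^sup>2 + 1))))}" (is "_ \<le> measure_pmf.prob _ ?G")
proof -
  define X where "X = real S * real A * real n ^ 2 / \<delta>"
  define L where "L = ln X"
  have "n \<noteq> 0" using \<beta>(1) by (cases n) (auto simp: \<beta>_def)
  then have n: "0 < n" by simp
  have L: "1 \<le> L" unfolding L_def X_def by (rule log_factor_ge_1[OF S A \<delta> not1 \<beta>[unfolded \<beta>_def]])
  have Xpos: "0 < X" using S A n \<delta> by (simp add: X_def)
  have "exp 1 \<le> X" using L Xpos by (simp add: L_def ln_ge_iff)
  then have X2: "2 \<le> X" using exp_ge_add_one_self[of 1] by linarith
  have \<beta>L: "\<beta> = sqrt (128 * L ^ 3 / real n)" by (simp add: \<beta>_def L_def X_def)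
  have "0 \<le> 128 * L ^ 3 / real n" using L by simp
  then have \<beta>2: "\<beta>\<^sup>2 = 128 * L ^ 3 / real n" unfolding \<beta>L by (rule real_sqrt_pow2)
  have "1 ^ 3 \<le> L ^ 3" using L by (intro power_mono) auto
  then have n\<beta>: "128 / real n \<le> \<beta>\<^sup>2" unfolding \<beta>2 by (intro divide_right_mono) auto
  \<comment> \<open>Chosen so that 2 n \<epsilon>^2 = 4 L, which makes the exponential in
    Hoeffding's bound equal to 1 / X^4.\<close>
  define \<epsilon> where "\<epsilon> = sqrt (2 * L / real n)"
  have \<epsilon>0: "0 \<le> \<epsilon>" using L by (simp add: \<epsilon>_def)
  have \<epsilon>2: "\<epsilon>\<^sup>2 = 2 * L / real n" unfolding \<epsilon>_def using L by (intro real_sqrt_pow2) auto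
  \<comment> \<open>Squared, this reads 2 L / n <= 128 L^3 / (64 n), which holds as L >= 1; hence
    the constant 128 = 2 * 64.\<close>
  have \<epsilon>\<beta>: "\<epsilon> \<le> \<beta> / 8"
  proof (rule power2_le_imp_le)
    have "L ^ 1 \<le> L ^ 3" using L by (intro power_increasing) auto
    then have "2 * L / real n \<le> 2 * L ^ 3 / real n" by (intro divide_right_mono) auto
    then show "\<epsilon>\<^sup>2 \<le> (\<beta> / 8)\<^sup>2" by (simp add: \<epsilon>2 \<beta>2 power_divide)
  qed (use \<beta> in simp)
  let ?p = "measure_pmf.prob (sample_pmf S A P n)"
  let ?bad = "{\<omega>. \<exists>s<S. \<exists>a<A. \<exists>k\<le>n\<^sup>2. loo_deviates S A P r (1 - \<beta>) n \<epsilon> s a k \<omega>}"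
  have "?p ?bad \<le> real S * real A * (real n ^ 2 + 1) * (2 * exp (- 2 * real n * \<epsilon>\<^sup>2))"
    by (rule loo_deviates_prob[OF P n \<epsilon>0])
  also have "exp (- 2 * real n * \<epsilon>\<^sup>2) = 1 / X ^ 4"
  proof -
    have "- 2 * real n * \<epsilon>\<^sup>2 = - (real 4 * L)" using n by (simp add: \<epsilon>2)
    then have "exp (- 2 * real n * \<epsilon>\<^sup>2) = 1 / exp L ^ 4" by (simp add: exp_minus exp_of_nat_mult[symmetric] divide_inverse)
    then show ?thesis using Xpos by (simp add: L_def)
  qed
  also have "real S * real A * (real n ^ 2 + 1) * (2 * (1 / X ^ 4)) \<le> \<delta>"
  proof (rule failure_prob_bound[OF \<delta>(1)])
    show "real S * real A * real n ^ 2 = X * \<delta>" using \<delta> by (simp add: X_def)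
    show "1 \<le> real n ^ 2" using n by simp
    have "2 ^ 3 \<le> X ^ 3" using X2 by (intro power_mono) auto
    then show "4 \<le> X ^ 3" by simp
  qed (use X2 in auto)
  finally have "1 - \<delta> \<le> 1 - ?p ?bad" by simp
  also have "\<dots> = ?p (- ?bad)" by (simp add: measure_pmf.prob_compl[symmetric] Compl_eq_Diff_UNIV)
  also have "\<dots> \<le> ?p ?G"
  proof (rule measure_pmf_mono_support)
    fix \<omega> assume \<omega>: "\<omega> \<in> set_pmf (sample_pmf S A P n)" and good: "\<omega> \<in> - ?bad"
    have "gain S A P r \<pi>star s - gain S A P r \<pi> s
         \<le> sqrt (18432 * (ln (real S * real A * real n / \<delta>)) ^ 3 / real n
                  * ((span_sp S (bias S A P r \<pi>star))\<^sup>2 + 1))"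
      if "is_policy S A \<pi>" "\<And>s. s < S \<Longrightarrow> opt_disc_value S A (emp_kernel n \<omega>) r (1 - \<beta>) s - 1 / real n
          \<le> disc_value S A (emp_kernel n \<omega>) r (1 - \<beta>) \<pi> s" "blackwell_optimal S A P r \<pi>star" "s < S" for \<pi> \<pi>star s
    proof -
      have "gain S A P r \<pi>star s - gain S A P r \<pi> s \<le> 3 * \<beta> * (span_sp S (bias S A P r \<pi>star) + 1)"
        by (rule good_event_gap[OF P r S A wc \<beta> n n\<beta> \<epsilon>0 \<epsilon>\<beta> \<omega> _ that]) (use good in auto)
      also have "\<dots> \<le> sqrt (18432 * (ln (real S * real A * real n / \<delta>)) ^ 3 / real n
                  * ((span_sp S (bias S A P r \<pi>star))\<^sup>2 + 1))"
        unfolding \<beta>L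
      proof (rule gap_rate_bound)
        show "L \<le> 2 * ln (real S * real A * real n / \<delta>)"
          unfolding L_def X_def by (rule log_factor_compare[OF S A \<delta> n])
        show "0 \<le> span_sp S (bias S A P r \<pi>star)" using span_sp_ge[OF S S] by fastforce
      qed (use L n in auto)
      finally show ?thesis .
    qed
    then show "\<omega> \<in> ?G" by blast
  qed
  finally show ?thesis .
qed

theorem mainTheorem12:
  "\<exists>C>0. \<exists>C'>0. \<forall>S A P r \<delta> n.
     S > 0 \<and> A > 0 \<and> is_kernel S A P \<and> is_reward S A r \<and> weakly_communicating S A P \<and>
     0 < \<delta> \<and> \<delta> < 1 \<and>
     (let \<gamma> = 1 - sqrt (C * (ln (real S * real A * real n ^ 2 / \<delta>)) ^ 3 / real n)
      in 0 < \<gamma> \<and> \<gamma> < 1) \<longrightarrow>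
     (let \<gamma> = 1 - sqrt (C * (ln (real S * real A * real n ^ 2 / \<delta>)) ^ 3 / real n)
      in measure_pmf.prob (sample_pmf S A P n)
          {\<omega>. \<forall>\<pi>. is_policy S A \<pi> \<and>
                 (\<forall>s<S. disc_value S A (emp_kernel n \<omega>) r \<gamma> \<pi> s
                          \<ge> opt_disc_value S A (emp_kernel n \<omega>) r \<gamma> s - 1 / real n) \<longrightarrow>
               (\<forall>\<pi>star. blackwell_optimal S A P r \<pi>star \<longrightarrow>
                 (\<forall>s<S. gain S A P r \<pi>star s - gain S A P r \<pi> s
                   \<le> sqrt (C' * (ln (real S * real A * real n / \<delta>)) ^ 3 / real n
                            * ((span_sp S (bias S A P r \<pi>star))^2 + 1))))}
        \<ge> 1 - \<delta>)"
proof (rule exI[of _ 128], rule conjI, simp, rule exI[of _ 18432], rule conjI, simp, unfold Let_def, intro allI impI)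
  fix S A :: nat and P r and \<delta> :: real and n :: nat
  let ?\<beta> = "sqrt (128 * (ln (real S * real A * real n ^ 2 / \<delta>)) ^ 3 / real n)"
  let ?G = "{\<omega>. \<forall>\<pi>. is_policy S A \<pi> \<and>
                 (\<forall>s<S. disc_value S A (emp_kernel n \<omega>) r (1 - ?\<beta>) \<pi> s
                          \<ge> opt_disc_value S A (emp_kernel n \<omega>) r (1 - ?\<beta>) s - 1 / real n) \<longrightarrow>
               (\<forall>\<pi>star. blackwell_optimal S A P r \<pi>star \<longrightarrow>
                 (\<forall>s<S. gain S A P r \<pi>star s - gain S A P r \<pi> s
                   \<le> sqrt (18432 * (ln (real S * real A * real n / \<delta>)) ^ 3 / real n
                            * ((span_sp S (bias S A P r \<pi>star))^2 + 1))))}"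
  assume "S > 0 \<and> A > 0 \<and> is_kernel S A P \<and> is_reward S A r \<and> weakly_communicating S A P \<and>
     0 < \<delta> \<and> \<delta> < 1 \<and> 0 < 1 - ?\<beta> \<and> 1 - ?\<beta> < 1"
  then have as: "0 < S" "0 < A" "is_kernel S A P" "is_reward S A r" "weakly_communicating S A P"
    "0 < \<delta>" "\<delta> < 1" "0 < ?\<beta>" "?\<beta> < 1" by auto
  show "1 - \<delta> \<le> measure_pmf.prob (sample_pmf S A P n) ?G"
  proof (cases "S = 1 \<and> A = 1 \<and> n = 1")
    \<comment> \<open>Here L = ln (1 / \<delta>) can be arbitrarily small. The gap is 0, and the
      positive logarithm makes the right side nonnegative, so the event is everything.\<close>
    case True
    have "1 < 1 / \<delta>" using as by simp
    then have "0 < ln (1 / \<delta>)" by (rule ln_gt_zero)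
    moreover have "gain 1 1 P r \<pi>star s - gain 1 1 P r \<pi> s = 0"
      if "is_policy 1 1 \<pi>" "blackwell_optimal 1 1 P r \<pi>star" "s < 1" for \<pi> \<pi>star s
      using gain_singleton[of P _ r] that as True by (simp add: blackwell_optimal_def)
    ultimately have "?G = UNIV" using True by (auto intro!: mult_nonneg_nonneg)
    then show ?thesis using as by simp
  next
    case False
    show ?thesis by (rule gain_gap_prob[OF as(1-7) False as(8,9)])
  qed
qed

end
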